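(* Let $(X,\phi)$ be a compact calibrated manifold, $p=\deg\phi$. Fix $S\in\mathcal E'_{p-1}(X)$ and $\lambda>0$. Then the following are equivalent. (i) There exists a $\Lambda_+(\phi)$-positive current $T\in\mathcal E'_p(X)$ with $S=\partial T$ and $M(T)\le\lambda$. (ii) $\int_S\alpha\ge-\lambda$ for all $\alpha\in\mathcal E^{p-1}(X)$ such that $d\alpha+\phi$ is $\Lambda^+(\phi)$-positive.
   Context: A calibrated manifold $(X,\phi)$ is an oriented Riemannian manifold $X$ with a smooth $d$-closed $p$-form $\phi$ of comass one, i.e. $\phi(\xi)\le 1$ for every unit simple $p$-vector $\xi$. $G(\phi)$ denotes the set of $\phi$-planes, i.e. unit simple $p$-vectors $\xi$ with $\phi(\xi)=1$. $\mathcal E^k(X)$ is the space of smooth $k$-forms on $X$ and $\mathcal E'_k(X)$ is its topological dual, the space of $k$-dimensional currents with compact support. $\int_S\alpha$ denotes $S(\alpha)$; the boundary is $(\partial T)(\alpha)=T(d\alpha)$; $M(T)$ is the mass of $T$ (the supremum of $T(\psi)$ over smooth $p$-forms $\psi$ with pointwise comass at most $1$). A smooth $p$-form $\beta$ is $\Lambda^+(\phi)$-positive if $\beta(\xi)\ge0$ for all $\xi\in G(\phi)$. A $p$-dimensional current $T$ is $\Lambda_+(\phi)$-positive if $T(\beta)\ge 0$ for all compactly supported $\Lambda^+(\phi)$-positive $p$-forms $\beta$. *)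

theory Defs
  imports "HOL-Analysis.Analysis" "HOL-Library.Function_Algebras"
begin

section \<open>Smooth maps on open sets\<close>

primrec higher_differentiable_on ::
  "nat \<Rightarrow> 'v::real_normed_vector set \<Rightarrow> ('v \<Rightarrow> 'w::real_normed_vector) \<Rightarrow> bool" where
  "higher_differentiable_on 0 U f \<longleftrightarrow> continuous_on U f"
| "higher_differentiable_on (Suc n) U f \<longleftrightarrow>
     (\<forall>y\<in>U. f differentiable (at y)) \<and>
     (\<forall>v. higher_differentiable_on n U (\<lambda>y. frechet_derivative f (at y) v))"

text \<open>Only used for open \<open>U\<close>; the behaviour of \<open>f\<close> outside \<open>U\<close> is then irrelevant.\<close>
definition smooth_on :: "'v::real_normed_vector set \<Rightarrow> ('v \<Rightarrow> 'w::real_normed_vector) \<Rightarrow> bool" where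
  "smooth_on U f \<longleftrightarrow> (\<forall>n. higher_differentiable_on n U f)"

text \<open>The iterated directional derivative along all the vectors of a list.\<close>
primrec iter_deriv ::
  "'v::real_normed_vector list \<Rightarrow> ('v \<Rightarrow> 'w::real_normed_vector) \<Rightarrow> 'v \<Rightarrow> 'w" where
  "iter_deriv [] f = f"
| "iter_deriv (b # bs) f = (\<lambda>y. frechet_derivative (iter_deriv bs f) (at y) b)"


section \<open>Oriented Riemannian manifolds\<close>

text \<open>A chart is its domain together with a coordinate map, whose values outside the domain do not
  matter. A tangent vector at a point \<open>x\<close> is the family of its coordinate vectors in all charts
  around \<open>x\<close>, extended by \<open>0\<close> to the other charts.\<close>

type_synonym ('a, 'n) chart = "'a set \<times> ('a \<Rightarrow> real ^ 'n)"

type_synonym ('a, 'n) tvec = "('a, 'n) chart \<Rightarrow> real ^ 'n"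

record ('a, 'n) riem_space =
  underlying :: "'a topology"
  atlas :: "('a, 'n) chart set"
  metric :: "'a \<Rightarrow> ('a, 'n) tvec \<Rightarrow> ('a, 'n) tvec \<Rightarrow> real"

abbreviation points :: "('a, 'n::finite) riem_space \<Rightarrow> 'a set" where
  "points M \<equiv> topspace (underlying M)"

definition chart_img :: "('a, 'n::finite) chart \<Rightarrow> (real ^ 'n) set" where
  "chart_img c = snd c ` fst c"

definition chart_inv :: "('a, 'n::finite) chart \<Rightarrow> real ^ 'n \<Rightarrow> 'a" where
  "chart_inv c = inv_into (fst c) (snd c)"

definition transition ::
  "('a, 'n::finite) chart \<Rightarrow> ('a, 'n) chart \<Rightarrow> real ^ 'n \<Rightarrow> real ^ 'n" where
  "transition c c' = snd c' \<circ> chart_inv c"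

definition is_chart :: "'a topology \<Rightarrow> ('a, 'n::finite) chart \<Rightarrow> bool" where
  "is_chart X c \<longleftrightarrow> openin X (fst c) \<and> open (chart_img c) \<and>
     homeomorphic_map (subtopology X (fst c)) (top_of_set (chart_img c)) (snd c)"

definition charts_at :: "('a, 'n::finite) riem_space \<Rightarrow> 'a \<Rightarrow> ('a, 'n) chart set" where
  "charts_at M x = {c \<in> atlas M. x \<in> fst c}"

text \<open>The orientation is part of the atlas: transition maps have positive Jacobian.\<close>
definition oriented_manifold :: "('a, 'n::finite) riem_space \<Rightarrow> bool" where
  "oriented_manifold M \<longleftrightarrow>
     Hausdorff_space (underlying M) \<and> second_countable (underlying M) \<and>
     (\<forall>c\<in>atlas M. is_chart (underlying M) c) \<and>
     (\<Union>c\<in>atlas M. fst c) = points M \<and>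
     (\<forall>c\<in>atlas M. \<forall>c'\<in>atlas M.
        smooth_on (snd c ` (fst c \<inter> fst c')) (transition c c') \<and>
        (\<forall>y \<in> snd c ` (fst c \<inter> fst c').
           det (matrix (frechet_derivative (transition c c') (at y))) > 0))"

definition tangent_space :: "('a, 'n::finite) riem_space \<Rightarrow> 'a \<Rightarrow> ('a, 'n) tvec set" where
  "tangent_space M x = {v.
     (\<forall>c. c \<notin> charts_at M x \<longrightarrow> v c = 0) \<and>
     (\<forall>c\<in>charts_at M x. \<forall>c'\<in>charts_at M x.
        v c' = frechet_derivative (transition c c') (at (snd c x)) (v c))}"

definition tscale :: "real \<Rightarrow> ('a, 'n::finite) tvec \<Rightarrow> ('a, 'n) tvec" where
  "tscale r v = (\<lambda>c. r *\<^sub>R v c)"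

text \<open>The tangent vector at \<open>x\<close> whose coordinate vector in the chart \<open>c\<close> is \<open>u\<close>.\<close>
definition coord_vec ::
  "('a, 'n::finite) riem_space \<Rightarrow> ('a, 'n) chart \<Rightarrow> 'a \<Rightarrow> real ^ 'n \<Rightarrow> ('a, 'n) tvec" where
  "coord_vec M c x u = (\<lambda>c'. if c' \<in> charts_at M x
     then frechet_derivative (transition c c') (at (snd c x)) u else 0)"

definition inner_product_on :: "('a, 'n::finite) tvec set \<Rightarrow>
    (('a, 'n) tvec \<Rightarrow> ('a, 'n) tvec \<Rightarrow> real) \<Rightarrow> bool" where
  "inner_product_on V g \<longleftrightarrow>
     (\<forall>u\<in>V. \<forall>v\<in>V. g u v = g v u) \<and>
     (\<forall>u\<in>V. \<forall>v\<in>V. \<forall>w\<in>V. g (u + v) w = g u w + g v w) \<and>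
     (\<forall>u\<in>V. \<forall>w\<in>V. \<forall>r. g (tscale r u) w = r * g u w) \<and>
     (\<forall>v\<in>V. v \<noteq> 0 \<longrightarrow> g v v > 0)"

definition oriented_riemannian_manifold :: "('a, 'n::finite) riem_space \<Rightarrow> bool" where
  "oriented_riemannian_manifold M \<longleftrightarrow>
     oriented_manifold M \<and>
     (\<forall>x\<in>points M. inner_product_on (tangent_space M x) (metric M x)) \<and>
     (\<forall>c\<in>atlas M. \<forall>u w. smooth_on (chart_img c)
        (\<lambda>y. metric M (chart_inv c y) (coord_vec M c (chart_inv c y) u)
                                      (coord_vec M c (chart_inv c y) w)))"


section \<open>Differential forms\<close>

type_synonym ('a, 'n) cov = "('a, 'n) tvec list \<Rightarrow> real"

type_synonym ('a, 'n) form = "'a \<Rightarrow> ('a, 'n) cov"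

text \<open>Alternating \<open>k\<close>-linear functions on the tangent space at \<open>x\<close>, extended by \<open>0\<close>.\<close>
definition alt_space :: "('a, 'n::finite) riem_space \<Rightarrow> nat \<Rightarrow> 'a \<Rightarrow> ('a, 'n) cov set" where
  "alt_space M k x = {\<omega>.
     (\<forall>vs. \<not> (length vs = k \<and> set vs \<subseteq> tangent_space M x) \<longrightarrow> \<omega> vs = 0) \<and>
     (\<forall>vs i. length vs = k \<and> set vs \<subseteq> tangent_space M x \<and> i < k \<longrightarrow>
        (\<forall>v\<in>tangent_space M x. \<forall>w\<in>tangent_space M x.
           \<omega> (vs[i := v + w]) = \<omega> (vs[i := v]) + \<omega> (vs[i := w])) \<and>
        (\<forall>v\<in>tangent_space M x. \<forall>r. \<omega> (vs[i := tscale r v]) = r * \<omega> (vs[i := v]))) \<and>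
     (\<forall>vs i j. length vs = k \<and> set vs \<subseteq> tangent_space M x \<and> i < j \<and> j < k \<and> vs ! i = vs ! j
        \<longrightarrow> \<omega> vs = 0)}"

text \<open>The component of \<open>\<alpha>\<close> along constant vectors \<open>us\<close>, as a function on the image of the chart.\<close>
definition local_rep :: "('a, 'n::finite) riem_space \<Rightarrow> ('a, 'n) chart \<Rightarrow> ('a, 'n) form \<Rightarrow>
    (real ^ 'n) list \<Rightarrow> real ^ 'n \<Rightarrow> real" where
  "local_rep M c \<alpha> us = (\<lambda>y. \<alpha> (chart_inv c y) (map (coord_vec M c (chart_inv c y)) us))"

definition smooth_forms :: "('a, 'n::finite) riem_space \<Rightarrow> nat \<Rightarrow> ('a, 'n) form set" where
  "smooth_forms M k = {\<alpha>.
     (\<forall>x\<in>points M. \<alpha> x \<in> alt_space M k x) \<and> (\<forall>x. x \<notin> points M \<longrightarrow> \<alpha> x = 0) \<and>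
     (\<forall>c\<in>atlas M. \<forall>us. length us = k \<longrightarrow> smooth_on (chart_img c) (local_rep M c \<alpha> us))}"

definition form_scale :: "real \<Rightarrow> ('a, 'n::finite) form \<Rightarrow> ('a, 'n) form" where
  "form_scale r \<alpha> = (\<lambda>x vs. r * \<alpha> x vs)"

text \<open>The usual coordinate formula
  \<open>(d\<alpha>)(u\<^sub>0, \<dots>, u\<^sub>k) = (\<Sum>i\<le>k. (-1)\<^sup>i D\<^bsub>u\<^sub>i\<^esub> (\<alpha>(u\<^sub>0, \<dots>, u\<^sub>k without u\<^sub>i)))\<close> for constant
  vectors. The result does not depend on the chart around \<open>x\<close>. The degree is read off from the
  length of the argument list; in other lengths \<open>\<alpha>\<close> and hence \<open>d\<alpha>\<close> vanish.\<close>
definition ext_d :: "('a, 'n::finite) riem_space \<Rightarrow> ('a, 'n) form \<Rightarrow> ('a, 'n) form" where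
  "ext_d M \<alpha> = (\<lambda>x vs.
     if x \<in> points M \<and> set vs \<subseteq> tangent_space M x then
       (let c = (SOME c. c \<in> charts_at M x); us = map (\<lambda>v. v c) vs in
          \<Sum>i<length us. (-1) ^ i *
            frechet_derivative (local_rep M c \<alpha> (take i us @ drop (Suc i) us))
              (at (snd c x)) (us ! i))
     else 0)"

definition compactly_supported :: "('a, 'n::finite) riem_space \<Rightarrow> ('a, 'n) form \<Rightarrow> bool" where
  "compactly_supported M \<alpha> \<longleftrightarrow>
     compactin (underlying M) (underlying M closure_of {x \<in> points M. \<alpha> x \<noteq> 0})"


section \<open>Calibrations\<close>

text \<open>\<open>p\<close>-vectors at \<open>x\<close> are elements of the dual of the space of alternating \<open>p\<close>-linear functions;
  \<open>wedge M x [v\<^sub>1, \<dots>, v\<^sub>p]\<close> is \<open>v\<^sub>1 \<and> \<dots> \<and> v\<^sub>p\<close>, and a \<open>p\<close>-form \<open>\<alpha>\<close> has the value \<open>\<xi> (\<alpha> x)\<close>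
  on a \<open>p\<close>-vector \<open>\<xi>\<close> at \<open>x\<close>.\<close>

type_synonym ('a, 'n) pvec = "('a, 'n) cov \<Rightarrow> real"

definition wedge ::
  "('a, 'n::finite) riem_space \<Rightarrow> 'a \<Rightarrow> ('a, 'n) tvec list \<Rightarrow> ('a, 'n) pvec" where
  "wedge M x vs = (\<lambda>\<omega>. if \<omega> \<in> alt_space M (length vs) x then \<omega> vs else 0)"

text \<open>The squared norm of \<open>v\<^sub>1 \<and> \<dots> \<and> v\<^sub>p\<close>, that is the determinant of the Gram matrix.\<close>
definition gram_det :: "('a, 'n::finite) riem_space \<Rightarrow> 'a \<Rightarrow> ('a, 'n) tvec list \<Rightarrow> real" where
  "gram_det M x vs = (\<Sum>\<pi> | \<pi> permutes {..<length vs}.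
     of_int (sign \<pi>) * (\<Prod>i<length vs. metric M x (vs ! i) (vs ! \<pi> i)))"

definition unit_simple ::
  "('a, 'n::finite) riem_space \<Rightarrow> nat \<Rightarrow> 'a \<Rightarrow> ('a, 'n) pvec set" where
  "unit_simple M p x = {wedge M x vs | vs.
     length vs = p \<and> set vs \<subseteq> tangent_space M x \<and> gram_det M x vs = 1}"

definition comass_le_one :: "('a, 'n::finite) riem_space \<Rightarrow> nat \<Rightarrow> ('a, 'n) form \<Rightarrow> bool" where
  "comass_le_one M p \<psi> \<longleftrightarrow> (\<forall>x\<in>points M. \<forall>\<xi>\<in>unit_simple M p x. \<xi> (\<psi> x) \<le> 1)"

definition calibrated_manifold ::
  "('a, 'n::finite) riem_space \<Rightarrow> nat \<Rightarrow> ('a, 'n) form \<Rightarrow> bool" where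
  "calibrated_manifold M p \<phi> \<longleftrightarrow> oriented_riemannian_manifold M \<and>
     \<phi> \<in> smooth_forms M p \<and> ext_d M \<phi> = 0 \<and> comass_le_one M p \<phi>"

definition phi_planes :: "('a, 'n::finite) riem_space \<Rightarrow> nat \<Rightarrow> ('a, 'n) form \<Rightarrow>
    ('a \<times> ('a, 'n) pvec) set" where
  "phi_planes M p \<phi> = {(x, \<xi>). x \<in> points M \<and> \<xi> \<in> unit_simple M p x \<and> \<xi> (\<phi> x) = 1}"

definition positive_form :: "('a, 'n::finite) riem_space \<Rightarrow> nat \<Rightarrow> ('a, 'n) form \<Rightarrow>
    ('a, 'n) form \<Rightarrow> bool" where
  "positive_form M p \<phi> \<beta> \<longleftrightarrow>
     \<beta> \<in> smooth_forms M p \<and> (\<forall>(x, \<xi>) \<in> phi_planes M p \<phi>. \<xi> (\<beta> x) \<ge> 0)"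


section \<open>Currents with compact support\<close>

text \<open>The \<open>C\<^sup>\<infinity>\<close> topology (uniform convergence on compact sets of all partial derivatives of all
  components), generated by the balls of the corresponding seminorms. Inserting the whole space
  only matters for the empty atlas.\<close>
definition form_topology ::
  "('a, 'n::finite) riem_space \<Rightarrow> nat \<Rightarrow> ('a, 'n) form topology" where
  "form_topology M k = topology_generated_by (insert (smooth_forms M k)
     {{\<beta> \<in> smooth_forms M k. \<forall>y\<in>K. \<bar>iter_deriv bs (local_rep M c (\<beta> - \<alpha>) us) y\<bar> < r}
      | \<alpha> c K bs us r. \<alpha> \<in> smooth_forms M k \<and> c \<in> atlas M \<and> compact K \<and> K \<subseteq> chart_img c \<and>
          set bs \<subseteq> Basis \<and> set us \<subseteq> Basis \<and> length us = k \<and> r > 0})"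

definition currents ::
  "('a, 'n::finite) riem_space \<Rightarrow> nat \<Rightarrow> (('a, 'n) form \<Rightarrow> real) set" where
  "currents M k = {T \<in> extensional (smooth_forms M k).
     (\<forall>\<alpha>\<in>smooth_forms M k. \<forall>\<beta>\<in>smooth_forms M k. T (\<alpha> + \<beta>) = T \<alpha> + T \<beta>) \<and>
     (\<forall>\<alpha>\<in>smooth_forms M k. \<forall>r. T (form_scale r \<alpha>) = r * T \<alpha>) \<and>
     continuous_map (form_topology M k) euclideanreal T}"

text \<open>The \<open>k\<close>-dimensional boundary of a \<open>(k+1)\<close>-dimensional current.\<close>
definition boundary :: "('a, 'n::finite) riem_space \<Rightarrow> nat \<Rightarrow> (('a, 'n) form \<Rightarrow> real) \<Rightarrow>
    ('a, 'n) form \<Rightarrow> real" where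
  "boundary M k T = restrict (\<lambda>\<alpha>. T (ext_d M \<alpha>)) (smooth_forms M k)"

definition mass ::
  "('a, 'n::finite) riem_space \<Rightarrow> nat \<Rightarrow> (('a, 'n) form \<Rightarrow> real) \<Rightarrow> ereal" where
  "mass M p T = (SUP \<psi> \<in> {\<psi> \<in> smooth_forms M p. comass_le_one M p \<psi>}. ereal (T \<psi>))"

definition positive_current :: "('a, 'n::finite) riem_space \<Rightarrow> nat \<Rightarrow> ('a, 'n) form \<Rightarrow>
    (('a, 'n) form \<Rightarrow> real) \<Rightarrow> bool" where
  "positive_current M p \<phi> T \<longleftrightarrow>
     (\<forall>\<beta>. positive_form M p \<phi> \<beta> \<and> compactly_supported M \<beta> \<longrightarrow> T \<beta> \<ge> 0)"

end

theory Submission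
  imports Defs
begin

text \<open>The easy implication evaluates \<open>T\<close> on the positive form \<open>d\<alpha> + \<phi>\<close>. For the converse, a current as
  desired is exactly a linear functional \<open>T\<close> on smooth \<open>p\<close>-forms that is nonnegative on positive forms,
  agrees with \<open>d\<alpha> \<mapsto> S \<alpha>\<close> on exact forms and satisfies \<open>T \<phi> \<le> l\<close>. All three conditions follow from
  \<open>T \<le> q\<close> for the sublinear functional
  \<open>q \<beta> = inf {S \<alpha> + l s | s \<ge> 0, d\<alpha> + s \<phi> - \<beta> positive}\<close>,
  so the Hahn--Banach theorem (\<open>hahn_banach\<close>) produces \<open>T\<close> as soon as \<open>q\<close> is finite. It is finite
  because \<open>\<phi>\<close> is an order unit for the cone of positive forms (\<open>phi_dominates\<close>): for large \<open>t\<close> both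
  \<open>t \<phi> - \<beta>\<close> and \<open>t \<phi> + \<beta>\<close> are positive. The first form makes the set of values nonempty, and the
  second one, by the hypothesis on \<open>S\<close>, bounds it below (\<open>costs_bdd_below\<close>).

  Mass and continuity come for free. A positive \<open>T\<close> satisfies \<open>T \<psi> \<le> T \<phi> \<le> l\<close> for each \<open>\<psi>\<close> of comass
  at most one, which is the mass bound. It is also continuous, because on a compact manifold the
  comass is dominated by finitely many \<open>C\<^sup>0\<close> seminorms in charts (\<open>comass_bound\<close>). The point there is
  that a unit simple \<open>p\<close>-vector may be represented by frames of arbitrarily long vectors; Gram--Schmidt
  replaces the frame by an orthogonal one without changing the value of any alternating function
  (\<open>alternating_bound_gram\<close>).

  For \<open>T (d\<alpha>)\<close> to make sense, \<open>d\<alpha>\<close> must be a smooth form. It has smooth components in every chart because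
  the exterior derivative does not depend on the chart in which it is computed
  (\<open>coord_d_chart_independent\<close>): the second derivatives of the transition
  maps are symmetric and their contributions cancel in pairs (\<open>coord_d_pullback\<close>).\<close>

section \<open>The Hahn--Banach theorem\<close>

text \<open>Positive homogeneity is only required as an inequality for \<open>r > 0\<close>; equality and the
  value \<open>0\<close> at \<open>0\<close> follow. The scalar multiplication is a parameter because forms are
  plain functions, scaled by \<^const>\<open>form_scale\<close>.\<close>
definition sublinear_on ::
  "'b::ab_group_add set \<Rightarrow> (real \<Rightarrow> 'b \<Rightarrow> 'b) \<Rightarrow> ('b \<Rightarrow> real) \<Rightarrow> bool" where
  "sublinear_on V scl f \<longleftrightarrow>
     (\<forall>x\<in>V. \<forall>y\<in>V. f (x + y) \<le> f x + f y) \<and> (\<forall>x\<in>V. \<forall>r>0. f (scl r x) \<le> r * f x)"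


locale real_subspace = vector_space scl for scl :: "real \<Rightarrow> 'b::ab_group_add \<Rightarrow> 'b" +
  fixes V :: "'b set"
  assumes V: "subspace V"
begin

lemma V_closed [simp]:
  "0 \<in> V" "x \<in> V \<Longrightarrow> y \<in> V \<Longrightarrow> x + y \<in> V" "x \<in> V \<Longrightarrow> scl r x \<in> V" "x \<in> V \<Longrightarrow> - x \<in> V"
  using V by (simp_all add: subspace_0 subspace_add subspace_scale subspace_neg)

lemma sublinear_scale:
  assumes "sublinear_on V scl f" "x \<in> V" "r > 0"
  shows "f (scl r x) = r * f x"
proof (rule antisym)
  show "f (scl r x) \<le> r * f x" using assms by (simp add: sublinear_on_def)
  have "f (scl (1 / r) (scl r x)) \<le> 1 / r * f (scl r x)"
    using assms unfolding sublinear_on_def by (metis V_closed(3) zero_less_divide_1_iff)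
  then show "r * f x \<le> f (scl r x)" using \<open>r > 0\<close> by (simp add: field_simps)
qed

lemma sublinear_0: "sublinear_on V scl f \<Longrightarrow> f 0 = 0"
  using sublinear_scale[of f 0 2] by simp

lemma sublinear_neg:
  assumes "sublinear_on V scl f" "x \<in> V" shows "- f (- x) \<le> f x"
proof -
  have "f (x + - x) \<le> f x + f (- x)"
    using assms unfolding sublinear_on_def by (meson V_closed(4))
  then show ?thesis using sublinear_0[OF assms(1)] by simp
qed

text \<open>If a sublinear \<open>f\<close> is minimal, then it agrees with \<open>x \<mapsto> inf\<^sub>t (f (x + t y) - t f y)\<close>, which
  is sublinear and below \<open>f\<close>, and whose value at \<open>- y\<close> is at most \<open>- f y\<close>. Hence \<open>f\<close> is odd.\<close>
lemma minimal_sublinear_odd: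
  assumes f: "sublinear_on V scl f"
    and min: "\<And>g. sublinear_on V scl g \<Longrightarrow> (\<And>x. x \<in> V \<Longrightarrow> g x \<le> f x) \<Longrightarrow> (\<And>x. x \<in> V \<Longrightarrow> g x = f x)"
    and y: "y \<in> V"
  shows "f (- y) = - f y"
proof -
  define F where "F = (\<lambda>x t. f (x + scl t y) - t * f y)"
  define g where "g = (\<lambda>x. INF t\<in>{0..}. F x t)"
  have f0: "f (scl t y) = t * f y" if "t \<ge> 0" for t
    using that sublinear_scale[OF f y] sublinear_0[OF f] by (cases "t = 0") auto
  have bdd: "bdd_below (F x ` {0..})" if "x \<in> V" for x
  proof (rule bdd_belowI2)
    fix t :: real assume "t \<in> {0..}"
    have "f ((x + scl t y) + - x) \<le> f (x + scl t y) + f (- x)"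
      using f that y unfolding sublinear_on_def by (meson V_closed)
    moreover have "f ((x + scl t y) + - x) = t * f y"
      using f0 \<open>t \<in> {0..}\<close> by (simp add: algebra_simps)
    ultimately show "- f (- x) \<le> F x t" by (simp add: F_def)
  qed
  have le: "g x \<le> F x t" if "x \<in> V" "t \<ge> 0" for x t
    unfolding g_def using that by (intro cINF_lower bdd) auto
  have ge: "c \<le> g x" if "\<And>t. t \<ge> 0 \<Longrightarrow> c \<le> F x t" for x c
    unfolding g_def using that by (intro cINF_greatest) auto
  have "sublinear_on V scl g"
    unfolding sublinear_on_def
  proof (intro conjI ballI allI impI)
    fix x z assume "x \<in> V" "z \<in> V"
    have "g (x + z) \<le> F x s + F z t" if "s \<ge> 0" "t \<ge> 0" for s t
    proof -
      have "g (x + z) \<le> F (x + z) (s + t)" using le \<open>x \<in> V\<close> \<open>z \<in> V\<close> that by simp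
      also have "f ((x + scl s y) + (z + scl t y)) \<le> f (x + scl s y) + f (z + scl t y)"
        using f \<open>x \<in> V\<close> \<open>z \<in> V\<close> y unfolding sublinear_on_def by (meson V_closed)
      then have "F (x + z) (s + t) \<le> F x s + F z t"
        by (simp add: F_def scale_left_distrib algebra_simps)
      finally show ?thesis .
    qed
    then have "g (x + z) - F x s \<le> g z" if "s \<ge> 0" for s
      using that by (intro ge) (simp add: algebra_simps)
    then have "g (x + z) - g z \<le> g x" by (intro ge) (simp add: algebra_simps)
    then show "g (x + z) \<le> g x + g z" by simp
  next
    fix x and r :: real assume "x \<in> V" "r > 0"
    have "g (scl r x) / r \<le> F x t" if "t \<ge> 0" for t
    proof -
      have "g (scl r x) \<le> F (scl r x) (r * t)" using le \<open>x \<in> V\<close> \<open>r > 0\<close> that by simp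
      also have "f (scl r (x + scl t y)) = r * f (x + scl t y)"
        using \<open>x \<in> V\<close> y \<open>r > 0\<close> by (intro sublinear_scale[OF f]) auto
      then have "F (scl r x) (r * t) = r * F x t"
        by (simp add: F_def scale_right_distrib algebra_simps)
      finally show ?thesis using \<open>r > 0\<close> by (simp add: field_simps)
    qed
    then have "g (scl r x) / r \<le> g x" by (rule ge)
    then show "g (scl r x) \<le> r * g x" using \<open>r > 0\<close> by (simp add: field_simps)
  qed
  moreover have "g x \<le> f x" if "x \<in> V" for x
    using le[OF that, of 0] by (simp add: F_def)
  ultimately have "g (- y) = f (- y)" using min y by (metis V_closed(4))
  moreover have "g (- y) \<le> - f y"
    using le[of "- y" 1] y sublinear_0[OF f] by (simp add: F_def)
  ultimately show ?thesis using sublinear_neg[OF f y] by simp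
qed

text \<open>The infimum stays finite because a sublinear \<open>f \<le> q\<close> satisfies \<open>f x \<ge> - q (- x)\<close>. Subadditivity
  passes to the infimum because two members of a chain have a common lower bound in the chain.\<close>
lemma sublinear_Inf_chain:
  assumes "C \<noteq> {}" and sub: "\<And>f. f \<in> C \<Longrightarrow> sublinear_on V scl f"
    and q: "\<And>f x. f \<in> C \<Longrightarrow> x \<in> V \<Longrightarrow> f x \<le> q x"
    and chain: "\<And>f g. f \<in> C \<Longrightarrow> g \<in> C \<Longrightarrow> (\<forall>x\<in>V. f x \<le> g x) \<or> (\<forall>x\<in>V. g x \<le> f x)"
  shows "sublinear_on V scl (\<lambda>x. INF f\<in>C. f x)"
    and "f \<in> C \<Longrightarrow> x \<in> V \<Longrightarrow> (INF f\<in>C. f x) \<le> f x"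
proof -
  have bdd: "bdd_below ((\<lambda>f. f x) ` C)" if "x \<in> V" for x
  proof (rule bdd_belowI2)
    fix f assume "f \<in> C"
    then show "- q (- x) \<le> f x"
      using sublinear_neg[OF sub that, of f] q[of f "- x"] that by force
  qed
  show le: "(INF f\<in>C. f x) \<le> f x" if "f \<in> C" "x \<in> V" for f x
    using that by (intro cINF_lower bdd)
  show "sublinear_on V scl (\<lambda>x. INF f\<in>C. f x)"
    unfolding sublinear_on_def
  proof (intro conjI ballI allI impI)
    fix x y assume xy: "x \<in> V" "y \<in> V"
    have *: "(INF f\<in>C. f (x + y)) \<le> f x + g y" if fg: "f \<in> C" "g \<in> C" for f g
    proof -
      obtain h where h: "h \<in> C" "\<forall>x\<in>V. h x \<le> f x" "\<forall>x\<in>V. h x \<le> g x"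
        using chain[OF fg] fg by auto
      have "(INF f\<in>C. f (x + y)) \<le> h (x + y)" using h xy by (intro le) auto
      also have "\<dots> \<le> h x + h y" using sub[OF h(1)] xy by (simp add: sublinear_on_def)
      also have "\<dots> \<le> f x + g y" using h xy by (simp add: add_mono)
      finally show ?thesis .
    qed
    have "(INF f\<in>C. f (x + y)) - f x \<le> g y" if "f \<in> C" "g \<in> C" for f g
      using *[OF that] by simp
    then have "(INF f\<in>C. f (x + y)) - f x \<le> (INF f\<in>C. f y)" if "f \<in> C" for f
      using that by (intro cINF_greatest assms(1))
    then have "(INF f\<in>C. f (x + y)) - (INF f\<in>C. f y) \<le> (INF f\<in>C. f x)"
      by (intro cINF_greatest assms(1)) (simp add: algebra_simps)
    then show "(INF f\<in>C. f (x + y)) \<le> (INF f\<in>C. f x) + (INF f\<in>C. f y)" by simp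
  next
    fix x and r :: real assume x: "x \<in> V" "r > 0"
    have "(INF f\<in>C. f (scl r x)) / r \<le> f x" if "f \<in> C" for f
      using le[OF that, of "scl r x"] sublinear_scale[OF sub[OF that] x] x
      by (simp add: field_simps)
    then have "(INF f\<in>C. f (scl r x)) / r \<le> (INF f\<in>C. f x)"
      by (intro cINF_greatest assms(1))
    then show "(INF f\<in>C. f (scl r x)) \<le> r * (INF f\<in>C. f x)"
      using \<open>r > 0\<close> by (simp add: field_simps)
  qed
qed

text \<open>By Zorn's lemma there is a minimal sublinear functional below \<open>q\<close>. It is odd, and an odd
  sublinear functional is linear. The functionals vanish outside \<open>V\<close> to make the pointwise order
  on \<open>V\<close> antisymmetric.\<close>
lemma hahn_banach:
  assumes q: "sublinear_on V scl q"
  obtains f where "\<And>x y. x \<in> V \<Longrightarrow> y \<in> V \<Longrightarrow> f (x + y) = f x + f y"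
    and "\<And>r x. x \<in> V \<Longrightarrow> f (scl r x) = r * f x" and "\<And>x. x \<in> V \<Longrightarrow> f x \<le> q x"
proof -
  define Q where "Q = {f. sublinear_on V scl f \<and> (\<forall>x\<in>V. f x \<le> q x) \<and> (\<forall>x. x \<notin> V \<longrightarrow> f x = 0)}"
  define P where "P = (\<lambda>f g. \<forall>x\<in>V. (g x :: real) \<le> f x)"
  have "\<exists>m\<in>Q. \<forall>a\<in>Q. P m a \<longrightarrow> a = m"
  proof (rule predicate_Zorn)
    show "partial_order_on Q (relation_of P Q)"
    proof (rule partial_order_on_relation_ofI)
      fix a b assume "a \<in> Q" "b \<in> Q" "P a b" "P b a"
      then show "a = b" unfolding P_def Q_def
          by (intro ext) (metis (mono_tags, lifting) antisym mem_Collect_eq)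
    qed (auto simp: P_def intro: order_trans)
    fix C assume "C \<in> Chains (relation_of P Q)"
    then have C: "C \<subseteq> Q" "\<And>f g. f \<in> C \<Longrightarrow> g \<in> C \<Longrightarrow> P f g \<or> P g f"
      unfolding Chains_def relation_of_def by auto
    show "\<exists>u\<in>Q. \<forall>a\<in>C. P a u"
    proof (cases "C = {}")
      case True
      have "sublinear_on V scl (\<lambda>x. if x \<in> V then q x else 0)"
        using q by (simp add: sublinear_on_def)
      then have "(\<lambda>x. if x \<in> V then q x else 0) \<in> Q" by (simp add: Q_def)
      then show ?thesis using True by blast
    next
      case False
      have Qs: "sublinear_on V scl f" "\<And>x. x \<in> V \<Longrightarrow> f x \<le> q x" if "f \<in> C" for f
        using that C(1) by (auto simp: Q_def)
      have chain: "(\<forall>x\<in>V. f x \<le> g x) \<or> (\<forall>x\<in>V. g x \<le> f x)" if "f \<in> C" "g \<in> C" for f g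
        using C(2)[OF that] by (auto simp: P_def)
      have Inf: "sublinear_on V scl (\<lambda>x. INF f\<in>C. f x)"
        by (rule sublinear_Inf_chain[where q = q]) (use False Qs chain in auto)
      have Inf_le: "(INF f\<in>C. f x) \<le> f x" if "f \<in> C" "x \<in> V" for f x
        by (rule sublinear_Inf_chain[where q = q]) (use False Qs chain that in auto)
      define u where "u = (\<lambda>x. if x \<in> V then INF f\<in>C. f x else 0)"
      have "sublinear_on V scl u"
        using Inf by (simp add: sublinear_on_def u_def)
      moreover have "u x \<le> q x" if "x \<in> V" for x
      proof -
        obtain f where "f \<in> C" using False by blast
        then show ?thesis using Inf_le[of f x] Qs(2)[of f x] that by (simp add: u_def)
      qed
      ultimately have "u \<in> Q" by (simp add: Q_def u_def)
      moreover have "P a u" if "a \<in> C" for a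
        using Inf_le that by (simp add: P_def u_def)
      ultimately show ?thesis by blast
    qed
  qed
  then obtain f where f: "f \<in> Q" and max: "\<And>g. g \<in> Q \<Longrightarrow> P f g \<Longrightarrow> g = f" by blast
  have sub: "sublinear_on V scl f" and fq: "\<And>x. x \<in> V \<Longrightarrow> f x \<le> q x"
    using f by (auto simp: Q_def)
  have min: "g x = f x" if g: "sublinear_on V scl g" "\<And>x. x \<in> V \<Longrightarrow> g x \<le> f x" and "x \<in> V" for g x
  proof -
    let ?g = "\<lambda>x. if x \<in> V then g x else 0"
    have "sublinear_on V scl ?g" using g(1) by (simp add: sublinear_on_def)
    then have "?g \<in> Q" using g(2) fq order_trans by (fastforce simp: Q_def)
    moreover have "P f ?g" using g(2) by (simp add: P_def)
    ultimately have "?g = f" by (rule max)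
    from fun_cong[OF this, of x] show ?thesis using \<open>x \<in> V\<close> by simp
  qed
  have odd: "f (- y) = - f y" if "y \<in> V" for y
    by (rule minimal_sublinear_odd[OF sub _ that]) (rule min)
  show thesis
  proof (rule that[of f])
    show "f (x + y) = f x + f y" if "x \<in> V" "y \<in> V" for x y
    proof (rule antisym)
      show "f (x + y) \<le> f x + f y" using sub that by (simp add: sublinear_on_def)
      have "f ((x + y) + - y) \<le> f (x + y) + f (- y)"
        using sub that unfolding sublinear_on_def by (meson V_closed)
      then show "f x + f y \<le> f (x + y)" using odd that by simp
    qed
    show "f (scl r x) = r * f x" if "x \<in> V" for r x
    proof (cases "r > 0")
      case True then show ?thesis using sublinear_scale[OF sub that] by simp
    next
      case False
      show ?thesis
      proof (cases "r = 0")
        case True then show ?thesis using sublinear_0[OF sub] by simp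
      next
        case nz: False
        have "f (scl r x) = f (- scl (- r) x)" by simp
        also have "\<dots> = - f (scl (- r) x)" using that by (intro odd) auto
        also have "\<dots> = r * f x" using sublinear_scale[OF sub that, of "- r"] False nz by simp
        finally show ?thesis .
      qed
    qed
  qed (use fq in auto)
qed

end


section \<open>Calculus of smooth maps\<close>

lemma frechet_derivative_cong_open:
  assumes "open U" "y \<in> U" "\<And>z. z \<in> U \<Longrightarrow> f z = g z"
  shows "frechet_derivative f (at y) = frechet_derivative g (at y)"
proof -
  have "(f has_derivative D) (at y) \<longleftrightarrow> (g has_derivative D) (at y)" for D
    using assms by (metis has_derivative_transform_within_open)
  then show ?thesis by (simp add: frechet_derivative_def)
qed

lemma higher_differentiable_on_cong:
  assumes "open U" and "\<And>y. y \<in> U \<Longrightarrow> f y = g y"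
  shows "higher_differentiable_on n U f \<longleftrightarrow> higher_differentiable_on n U g"
  using assms(2)
proof (induction n arbitrary: f g)
  case 0
  then show ?case by (simp cong: continuous_on_cong)
next
  case (Suc n)
  have 1: "f differentiable (at y) \<longleftrightarrow> g differentiable (at y)" if "y \<in> U" for y
    using Suc.prems that assms(1) unfolding differentiable_def
    by (metis has_derivative_transform_within_open)
  have 2: "frechet_derivative f (at y) v = frechet_derivative g (at y) v" if "y \<in> U" for y v
    using frechet_derivative_cong_open[OF assms(1) that Suc.prems] by simp
  have "higher_differentiable_on n U (\<lambda>y. frechet_derivative f (at y) v) \<longleftrightarrow>
        higher_differentiable_on n U (\<lambda>y. frechet_derivative g (at y) v)" for v
    using 2 by (intro Suc.IH) auto
  then show ?case using 1 by simp
qed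

lemma higher_differentiable_on_SucD:
  "higher_differentiable_on (Suc n) U f \<Longrightarrow> higher_differentiable_on n U f"
proof (induction n arbitrary: f)
  case 0
  then show ?case
    by (auto intro!: continuous_at_imp_continuous_on differentiable_imp_continuous_within)
next
  case (Suc n)
  from Suc.prems show ?case
    by (subst higher_differentiable_on.simps(2), subst (asm) higher_differentiable_on.simps(2))
       (use Suc.IH in blast)
qed

lemma higher_differentiable_on_const: "higher_differentiable_on n U (\<lambda>_. c)"
  by (induction n arbitrary: c) (auto simp: frechet_derivative_const)

text \<open>Avoids the choice hidden in \<^const>\<open>frechet_derivative\<close>: any family of derivatives will do.\<close>
lemma higher_differentiable_on_SucI:
  assumes "open U" and D: "\<And>y. y \<in> U \<Longrightarrow> (f has_derivative D y) (at y)"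
    and "\<And>v. higher_differentiable_on n U (\<lambda>y. D y v)"
  shows "higher_differentiable_on (Suc n) U f"
proof -
  have "frechet_derivative f (at y) v = D y v" if "y \<in> U" for y v
    using frechet_derivative_at[OF D[OF that]] by simp
  then have "higher_differentiable_on n U (\<lambda>y. frechet_derivative f (at y) v) \<longleftrightarrow>
      higher_differentiable_on n U (\<lambda>y. D y v)" for v
    by (intro higher_differentiable_on_cong assms)
  then show ?thesis using assms by (auto intro: differentiableI)
qed

lemma higher_differentiable_on_add:
  assumes "open U" "higher_differentiable_on n U f" "higher_differentiable_on n U g"
  shows "higher_differentiable_on n U (\<lambda>y. f y + g y)"
  using assms(2,3)
proof (induction n arbitrary: f g)
  case 0
  then show ?case by (auto intro: continuous_intros)
next
  case (Suc n)
  show ?case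
  proof (rule higher_differentiable_on_SucI[OF assms(1)])
    show "((\<lambda>y. f y + g y) has_derivative
        (\<lambda>v. frechet_derivative f (at y) v + frechet_derivative g (at y) v)) (at y)"
      if "y \<in> U" for y
      using Suc.prems that by (auto intro!: has_derivative_add simp flip: frechet_derivative_works)
  qed (use Suc in auto)
qed

lemma higher_differentiable_on_bilinear:
  assumes "open U" and bl: "bounded_bilinear prd"
    and "higher_differentiable_on n U f" "higher_differentiable_on n U g"
  shows "higher_differentiable_on n U (\<lambda>y. prd (f y) (g y))"
  using assms(3,4)
proof (induction n arbitrary: f g)
  case 0
  then show ?case by (auto intro: bounded_bilinear.continuous_on[OF bl])
next
  case (Suc n)
  show ?case
  proof (rule higher_differentiable_on_SucI[OF assms(1)])
    show "((\<lambda>y. prd (f y) (g y)) has_derivative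
       (\<lambda>v. prd (f y) (frechet_derivative g (at y) v) + prd (frechet_derivative f (at y) v) (g y)))
       (at y)" if "y \<in> U" for y
      using Suc.prems that
      by (intro bounded_bilinear.FDERIV[OF bl]) (auto simp flip: frechet_derivative_works)
    show "higher_differentiable_on n U (\<lambda>y.
      prd (f y) (frechet_derivative g (at y) v) + prd (frechet_derivative f (at y) v) (g y))" for v
      using Suc.prems higher_differentiable_on_SucD[OF Suc.prems(1)]
        higher_differentiable_on_SucD[OF Suc.prems(2)]
      by (intro higher_differentiable_on_add assms Suc.IH) auto
  qed
qed

lemma higher_differentiable_on_sum:
  assumes "open U" "\<And>i. i \<in> I \<Longrightarrow> higher_differentiable_on n U (f i)"
  shows "higher_differentiable_on n U (\<lambda>y. \<Sum>i\<in>I. f i y)"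
  using assms(2)
  by (induction I rule: infinite_finite_induct)
     (auto simp: higher_differentiable_on_const intro!: higher_differentiable_on_add[OF assms(1)])

lemma smooth_on_cong:
  assumes "open U" and "\<And>y. y \<in> U \<Longrightarrow> f y = g y"
  shows "smooth_on U f \<longleftrightarrow> smooth_on U g"
  using higher_differentiable_on_cong[OF assms] by (simp add: smooth_on_def)

lemma smooth_on_const: "smooth_on U (\<lambda>_. c)"
  by (simp add: smooth_on_def higher_differentiable_on_const)

lemma smooth_on_add:
  "open U \<Longrightarrow> smooth_on U f \<Longrightarrow> smooth_on U g \<Longrightarrow> smooth_on U (\<lambda>y. f y + g y)"
  by (simp add: smooth_on_def higher_differentiable_on_add)

lemma smooth_on_sum:
  "open U \<Longrightarrow> (\<And>i. i \<in> I \<Longrightarrow> smooth_on U (f i)) \<Longrightarrow> smooth_on U (\<lambda>y. \<Sum>i\<in>I. f i y)"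
  by (simp add: smooth_on_def higher_differentiable_on_sum)

lemma smooth_on_mult:
  fixes f g :: "'v::real_normed_vector \<Rightarrow> real"
  shows "open U \<Longrightarrow> smooth_on U f \<Longrightarrow> smooth_on U g \<Longrightarrow> smooth_on U (\<lambda>y. f y * g y)"
  by (simp add: smooth_on_def higher_differentiable_on_bilinear[OF _ bounded_bilinear_mult])

lemma smooth_on_inner_const:
  fixes f :: "'v::real_normed_vector \<Rightarrow> 'w::real_inner"
  shows "open U \<Longrightarrow> smooth_on U f \<Longrightarrow> smooth_on U (\<lambda>y. f y \<bullet> b)"
  by (simp add: smooth_on_def higher_differentiable_on_const
      higher_differentiable_on_bilinear[OF _ bounded_bilinear_inner])

lemma smooth_on_frechet_derivative:
  "smooth_on U f \<Longrightarrow> smooth_on U (\<lambda>y. frechet_derivative f (at y) v)"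
  unfolding smooth_on_def using higher_differentiable_on.simps(2) by blast

lemma smooth_on_imp_differentiable: "smooth_on U f \<Longrightarrow> y \<in> U \<Longrightarrow> f differentiable (at y)"
  unfolding smooth_on_def using higher_differentiable_on.simps(2) by blast

lemma smooth_on_imp_continuous_on: "smooth_on U f \<Longrightarrow> continuous_on U f"
  unfolding smooth_on_def using higher_differentiable_on.simps(1) by blast

text \<open>Two applications of the mean value theorem express the second difference
  \<open>f (y + h u + h w) - f (y + h u) - f (y + h w) + f y\<close> by a second derivative nearby.\<close>
lemma second_difference:
  fixes f :: "'v::real_normed_vector \<Rightarrow> real"
  assumes U: "\<And>s t. 0 \<le> s \<Longrightarrow> s \<le> h \<Longrightarrow> 0 \<le> t \<Longrightarrow> t \<le> h \<Longrightarrow> y + s *\<^sub>R u + t *\<^sub>R w \<in> U"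
    and "smooth_on U f" "h > 0"
  obtains s t where "0 \<le> s" "s \<le> h" "0 \<le> t" "t \<le> h"
    "f (y + h *\<^sub>R u + h *\<^sub>R w) - f (y + h *\<^sub>R u) - f (y + h *\<^sub>R w) + f y =
      h * h * frechet_derivative (\<lambda>z. frechet_derivative f (at z) u) (at (y + s *\<^sub>R u + t *\<^sub>R w)) w"
proof -
  let ?g = "\<lambda>s. f (y + s *\<^sub>R u + h *\<^sub>R w) - f (y + s *\<^sub>R u)"
  let ?Du = "\<lambda>z. frechet_derivative f (at z) u"
  have line: "((\<lambda>s. g (a + s *\<^sub>R v)) has_real_derivative
      frechet_derivative g (at (a + s *\<^sub>R v)) v) (at s)"
    if "smooth_on U g" "a + s *\<^sub>R v \<in> U" for g :: "'v \<Rightarrow> real" and a v s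
  proof -
    have g: "(g has_derivative frechet_derivative g (at (a + s *\<^sub>R v))) (at (a + s *\<^sub>R v))"
      using that smooth_on_imp_differentiable frechet_derivative_works by blast
    have "((\<lambda>s. a + s *\<^sub>R v) has_derivative (\<lambda>r. r *\<^sub>R v)) (at s)"
      by (auto intro!: derivative_eq_intros)
    from has_derivative_compose[OF this g]
    have "((\<lambda>s. g (a + s *\<^sub>R v)) has_derivative
        (\<lambda>r. frechet_derivative g (at (a + s *\<^sub>R v)) (r *\<^sub>R v))) (at s)" .
    moreover have "frechet_derivative g (at (a + s *\<^sub>R v)) (r *\<^sub>R v) =
        frechet_derivative g (at (a + s *\<^sub>R v)) v * r" for r
      using has_derivative_linear[OF g] by (simp add: linear_cmul)
    ultimately show ?thesis by (simp add: has_field_derivative_def mult_commute_abs)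
  qed
  have 1: "(?g has_real_derivative
      (?Du (y + s *\<^sub>R u + h *\<^sub>R w) - ?Du (y + s *\<^sub>R u))) (at s)" if "0 \<le> s" "s \<le> h" for s
  proof -
    have "((\<lambda>s. f ((y + h *\<^sub>R w) + s *\<^sub>R u)) has_real_derivative
        ?Du ((y + h *\<^sub>R w) + s *\<^sub>R u)) (at s)"
      using U[of s h] that assms by (intro line) (auto simp: algebra_simps)
    moreover have "((\<lambda>s. f (y + s *\<^sub>R u)) has_real_derivative ?Du (y + s *\<^sub>R u)) (at s)"
      using U[of s 0] that assms by (intro line) (auto simp: algebra_simps)
    ultimately show ?thesis
      by (auto intro!: derivative_eq_intros simp: algebra_simps)
  qed
  have "\<exists>s. 0 < s \<and> s < h \<and>
      ?g h - ?g 0 = (h - 0) * (?Du (y + s *\<^sub>R u + h *\<^sub>R w) - ?Du (y + s *\<^sub>R u))"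
    by (rule MVT2[OF \<open>h > 0\<close> 1])
  then obtain s where s: "0 < s" "s < h"
    "?g h - ?g 0 = (h - 0) * (?Du (y + s *\<^sub>R u + h *\<^sub>R w) - ?Du (y + s *\<^sub>R u))"
    by blast
  have 2: "((\<lambda>t. ?Du (y + s *\<^sub>R u + t *\<^sub>R w)) has_real_derivative
      frechet_derivative ?Du (at (y + s *\<^sub>R u + t *\<^sub>R w)) w) (at t)" if "0 \<le> t" "t \<le> h" for t
    using U[of s t] s that assms by (intro line smooth_on_frechet_derivative) auto
  have "\<exists>t. 0 < t \<and> t < h \<and>
      ?Du (y + s *\<^sub>R u + h *\<^sub>R w) - ?Du (y + s *\<^sub>R u + 0 *\<^sub>R w) =
      (h - 0) * frechet_derivative ?Du (at (y + s *\<^sub>R u + t *\<^sub>R w)) w"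
    by (rule MVT2[OF \<open>h > 0\<close> 2])
  then obtain t where t: "0 < t" "t < h"
    "?Du (y + s *\<^sub>R u + h *\<^sub>R w) - ?Du (y + s *\<^sub>R u + 0 *\<^sub>R w) =
      (h - 0) * frechet_derivative ?Du (at (y + s *\<^sub>R u + t *\<^sub>R w)) w"
    by blast
  show thesis
    by (rule that[of s t]) (use s t in \<open>auto simp: algebra_simps\<close>)
qed

text \<open>Schwarz's theorem: the second difference is symmetric in the two directions, and both mixed
  derivatives are its limits by continuity.\<close>
lemma mixed_derivatives_commute_real:
  fixes f :: "'v::real_normed_vector \<Rightarrow> real"
  assumes "open U" "smooth_on U f" "y \<in> U"
  shows "frechet_derivative (\<lambda>z. frechet_derivative f (at z) u) (at y) w =
         frechet_derivative (\<lambda>z. frechet_derivative f (at z) w) (at y) u"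
proof -
  define A where "A = (\<lambda>z. frechet_derivative (\<lambda>z. frechet_derivative f (at z) u) (at z) w)"
  define B where "B = (\<lambda>z. frechet_derivative (\<lambda>z. frechet_derivative f (at z) w) (at z) u)"
  have cont: "continuous_on U A" "continuous_on U B"
    unfolding A_def B_def
    using assms by (auto intro!: smooth_on_imp_continuous_on smooth_on_frechet_derivative)
  have "\<bar>A y - B y\<bar> < 2 * e" if "e > 0" for e
  proof -
    have "isCont A y" "isCont B y"
      using cont assms by (auto simp: continuous_on_eq_continuous_at)
    then obtain d1 d2 where d: "d1 > 0" "\<And>z. dist z y < d1 \<Longrightarrow> dist (A z) (A y) < e"
       "d2 > 0" "\<And>z. dist z y < d2 \<Longrightarrow> dist (B z) (B y) < e"
      unfolding continuous_at_eps_delta using \<open>e > 0\<close> by (metis dist_norm)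
    obtain d3 where d3: "d3 > 0" "ball y d3 \<subseteq> U" using assms by (meson openE)
    define \<delta> where "\<delta> = min d1 (min d2 d3)"
    \<comment> \<open>this small, the parallelogram spanned by \<open>h u\<close> and \<open>h w\<close> at \<open>y\<close> stays \<open>\<delta>\<close>-close to \<open>y\<close>\<close>
    define h where "h = \<delta> / (2 * (norm u + norm w + 1))"
    have "\<delta> > 0" using d d3 by (simp add: \<delta>_def)
    have pos: "norm u + norm w + 1 > 0" by (smt (verit) norm_ge_zero)
    have "h > 0" using \<open>\<delta> > 0\<close> pos by (simp add: h_def)
    have near: "dist (y + s *\<^sub>R u + t *\<^sub>R w) y < \<delta>"
      if "0 \<le> s" "s \<le> h" "0 \<le> t" "t \<le> h" for s t
    proof -
      have "dist (y + s *\<^sub>R u + t *\<^sub>R w) y \<le> norm (s *\<^sub>R u) + norm (t *\<^sub>R w)"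
        by (simp add: dist_norm add.assoc norm_triangle_ineq del: norm_scaleR)
      also have "\<dots> \<le> h * norm u + h * norm w"
        using that by (simp add: add_mono mult_right_mono)
      also have "\<dots> < h * (2 * (norm u + norm w + 1))"
        using \<open>h > 0\<close> by (simp add: algebra_simps add_strict_increasing2 add_pos_nonneg)
      also have "\<dots> = \<delta>" using pos by (simp add: h_def)
      finally show ?thesis .
    qed
    have near': "dist (y + t *\<^sub>R w + s *\<^sub>R u) y < \<delta>"
      if "0 \<le> s" "s \<le> h" "0 \<le> t" "t \<le> h" for s t
      using near[OF that] by (simp add: algebra_simps)
    have inU: "z \<in> U" if "dist z y < \<delta>" for z
      using d3 that by (auto simp: \<delta>_def dist_commute)
    obtain s t where 1: "0 \<le> s" "s \<le> h" "0 \<le> t" "t \<le> h"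
      "f (y + h *\<^sub>R u + h *\<^sub>R w) - f (y + h *\<^sub>R u) - f (y + h *\<^sub>R w) + f y =
        h * h * A (y + s *\<^sub>R u + t *\<^sub>R w)"
      unfolding A_def
      by (rule second_difference[OF _ assms(2) \<open>h > 0\<close>, of y u w]) (use near inU in auto)
    obtain s' t' where 2: "0 \<le> s'" "s' \<le> h" "0 \<le> t'" "t' \<le> h"
      "f (y + h *\<^sub>R w + h *\<^sub>R u) - f (y + h *\<^sub>R w) - f (y + h *\<^sub>R u) + f y =
        h * h * B (y + s' *\<^sub>R w + t' *\<^sub>R u)"
      unfolding B_def
      by (rule second_difference[OF _ assms(2) \<open>h > 0\<close>, of y w u]) (use near' inU in auto)
    have "h * h * A (y + s *\<^sub>R u + t *\<^sub>R w) = h * h * B (y + s' *\<^sub>R w + t' *\<^sub>R u)"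
      unfolding 1(5)[symmetric] 2(5)[symmetric] by (simp add: algebra_simps)
    then have "A (y + s *\<^sub>R u + t *\<^sub>R w) = B (y + s' *\<^sub>R w + t' *\<^sub>R u)"
      using \<open>h > 0\<close> by simp
    moreover have "dist (A (y + s *\<^sub>R u + t *\<^sub>R w)) (A y) < e"
      using near[OF 1(1-4)] by (intro d) (auto simp: \<delta>_def)
    moreover have "dist (B (y + s' *\<^sub>R w + t' *\<^sub>R u)) (B y) < e"
      using near'[OF 2(3,4) 2(1,2)] by (intro d) (auto simp: \<delta>_def)
    ultimately show ?thesis by (simp add: dist_real_def)
  qed
  from this[of "\<bar>A y - B y\<bar> / 2"] have "A y = B y" by fastforce
  then show ?thesis by (simp add: A_def B_def)
qed

lemma frechet_derivative_inner_const:
  fixes f :: "'v::real_normed_vector \<Rightarrow> 'w::real_inner"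
  assumes "f differentiable (at y)"
  shows "frechet_derivative (\<lambda>z. f z \<bullet> b) (at y) v = frechet_derivative f (at y) v \<bullet> b"
proof -
  have "((\<lambda>z. f z \<bullet> b) has_derivative (\<lambda>v. frechet_derivative f (at y) v \<bullet> b)) (at y)"
    using assms by (intro has_derivative_inner_left) (simp add: frechet_derivative_works)
  then show ?thesis using frechet_derivative_at by metis
qed

lemma mixed_derivatives_commute:
  fixes f :: "'v::real_normed_vector \<Rightarrow> 'w::euclidean_space"
  assumes "open U" "smooth_on U f" "y \<in> U"
  shows "frechet_derivative (\<lambda>z. frechet_derivative f (at z) u) (at y) w =
         frechet_derivative (\<lambda>z. frechet_derivative f (at z) w) (at y) u"
proof (rule euclidean_eqI)
  fix b :: 'w
  have *: "frechet_derivative (\<lambda>z. frechet_derivative f (at z) u) (at y) w \<bullet> b =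
      frechet_derivative (\<lambda>z. frechet_derivative (\<lambda>z. f z \<bullet> b) (at z) u) (at y) w" for u w
  proof -
    have "frechet_derivative (\<lambda>z. frechet_derivative f (at z) u) (at y) w \<bullet> b =
        frechet_derivative (\<lambda>z. frechet_derivative f (at z) u \<bullet> b) (at y) w"
      using assms smooth_on_frechet_derivative smooth_on_imp_differentiable
      by (metis frechet_derivative_inner_const)
    also have "frechet_derivative (\<lambda>z. frechet_derivative f (at z) u \<bullet> b) (at y) =
        frechet_derivative (\<lambda>z. frechet_derivative (\<lambda>z. f z \<bullet> b) (at z) u) (at y)"
      using assms smooth_on_imp_differentiable
      by (intro frechet_derivative_cong_open[of U])
         (auto intro!: frechet_derivative_inner_const[symmetric])
    finally show ?thesis .
  qed
  show "frechet_derivative (\<lambda>z. frechet_derivative f (at z) u) (at y) w \<bullet> b =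
      frechet_derivative (\<lambda>z. frechet_derivative f (at z) w) (at y) u \<bullet> b"
    unfolding * using assms
    by (intro mixed_derivatives_commute_real[of U] smooth_on_inner_const) auto
qed


section \<open>Alternating multilinear functions\<close>

definition multilinear :: "nat \<Rightarrow> ('v::real_vector list \<Rightarrow> real) \<Rightarrow> bool" where
  "multilinear k m \<longleftrightarrow> (\<forall>us i. length us = k \<and> i < k \<longrightarrow>
     (\<forall>v w. m (us[i := v + w]) = m (us[i := v]) + m (us[i := w])) \<and>
     (\<forall>r v. m (us[i := r *\<^sub>R v]) = r * m (us[i := v])))"

definition alternating :: "nat \<Rightarrow> ('v::real_vector list \<Rightarrow> real) \<Rightarrow> bool" where
  "alternating k m \<longleftrightarrow> multilinear k m \<and>
     (\<forall>us i j. length us = k \<and> i < j \<and> j < k \<and> us ! i = us ! j \<longrightarrow> m us = 0)"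

lemma multilinear_slot:
  assumes "multilinear k m" "length us = k" "i < k"
  shows "linear (\<lambda>v. m (us[i := v]))"
  using assms by (intro linearI) (simp_all add: multilinear_def)

lemma multilinear_middle:
  assumes "multilinear k m" "length xs + length ys + 1 = k"
  shows "linear (\<lambda>v. m (xs @ v # ys))"
proof -
  have "(xs @ 0 # ys)[length xs := v] = xs @ v # ys" for v by (simp add: list_update_append)
  then show ?thesis using multilinear_slot[OF assms(1), of "xs @ 0 # ys" "length xs"] assms(2) by simp
qed

lemma alternating_imp_multilinear: "alternating k m \<Longrightarrow> multilinear k m"
  by (simp add: alternating_def)

lemma alternating_repeat:
  "alternating k m \<Longrightarrow> length us = k \<Longrightarrow> i < k \<Longrightarrow> j < k \<Longrightarrow> i \<noteq> j \<Longrightarrow> us ! i = us ! j \<Longrightarrow> m us = 0"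
  unfolding alternating_def by (metis nat_neq_iff)

lemma alternating_swap_adjacent:
  assumes "alternating k m" "length xs + length ys + 2 = k"
  shows "m (xs @ a # b # ys) = - m (xs @ b # a # ys)"
proof -
  have z: "m (xs @ c # c # ys) = 0" for c
    using assms(2) by (intro alternating_repeat[OF assms(1), of _ "length xs" "Suc (length xs)"])
      (auto simp: nth_append)
  have l1: "linear (\<lambda>v. m (xs @ v # c # ys))" for c
    using assms multilinear_middle[of k m xs "c # ys"] by (simp add: alternating_def)
  have l2: "linear (\<lambda>v. m (xs @ c # v # ys))" for c
    using assms multilinear_middle[of k m "xs @ [c]" ys] by (simp add: alternating_def)
  have "m (xs @ (a + b) # (a + b) # ys) = m (xs @ a # b # ys) + m (xs @ b # a # ys)"
    using z[of a] z[of b] by (simp add: linear_add[OF l1] linear_add[OF l2])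
  then show ?thesis using z[of "a + b"] by simp
qed

text \<open>Each of the adjacent transpositions that carry \<open>q\<close> past \<open>ys\<close> changes the sign.\<close>
lemma alternating_move:
  assumes "alternating k m" "length xs + length ys + length zs + 1 = k"
  shows "m (xs @ q # ys @ zs) = (-1) ^ length ys * m (xs @ ys @ q # zs)"
  using assms(2)
proof (induction ys arbitrary: xs)
  case Nil
  then show ?case by simp
next
  case (Cons a ys)
  have "m (xs @ q # (a # ys) @ zs) = - m ((xs @ [a]) @ q # ys @ zs)"
    using alternating_swap_adjacent[OF assms(1), of xs "ys @ zs" q a] Cons.prems by simp
  also have "m ((xs @ [a]) @ q # ys @ zs) = (-1) ^ length ys * m ((xs @ [a]) @ ys @ q # zs)"
    using Cons.prems by (intro Cons.IH) simp
  finally show ?case by simp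
qed

text \<open>Each added multiple contributes a value with a repeated argument, that is \<open>0\<close>. This is the step
  of the Gram--Schmidt process.\<close>
lemma alternating_add_combination:
  assumes "alternating k m" "length us = k" "j < k" "finite I" "I \<subseteq> {..<k} - {j}"
  shows "m (us[j := us ! j + (\<Sum>i\<in>I. a i *\<^sub>R us ! i)]) = m us"
proof -
  have lin: "linear (\<lambda>v. m (us[j := v]))"
    using assms by (auto intro: multilinear_slot simp: alternating_def)
  have "m (us[j := us ! i]) = 0" if "i \<in> I" for i
    using assms that by (intro alternating_repeat[OF assms(1), of _ i j]) (auto simp: nth_list_update)
  then show ?thesis
    by (simp add: linear_add[OF lin] linear_sum[OF lin] linear_cmul[OF lin] o_def)
qed

lemma multilinear_Cons:
  assumes "multilinear (Suc k) m" shows "multilinear k (\<lambda>us. m (u # us))"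
  unfolding multilinear_def
proof (intro allI impI)
  fix us :: "'a list" and i assume "length us = k \<and> i < k"
  then have "linear (\<lambda>v. m ((u # us)[Suc i := v]))" by (intro multilinear_slot[OF assms]) auto
  then show "(\<forall>v w. m (u # us[i := v + w]) = m (u # us[i := v]) + m (u # us[i := w])) \<and>
     (\<forall>r v. m (u # us[i := r *\<^sub>R v]) = r * m (u # us[i := v]))"
    by (simp add: linear_iff)
qed

abbreviation basis_lists :: "nat \<Rightarrow> 'v::euclidean_space list set" where
  "basis_lists k \<equiv> {bs. set bs \<subseteq> Basis \<and> length bs = k}"

lemma finite_basis_lists: "finite (basis_lists k :: 'v::euclidean_space list set)"
  by (rule finite_lists_length_eq) simp

lemma multilinear_expansion:
  fixes m :: "'v::euclidean_space list \<Rightarrow> real"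
  assumes "multilinear k m" "length us = k"
  shows "m us = (\<Sum>bs\<in>basis_lists k. (\<Prod>i<k. us ! i \<bullet> bs ! i) * m bs)"
  using assms
proof (induction k arbitrary: m us)
  case 0
  then have "basis_lists 0 = {[] :: 'v list}" "us = []" by auto
  then show ?case by simp
next
  case (Suc k)
  then obtain u vs where us: "us = u # vs" "length vs = k" by (auto simp: length_Suc_conv)
  have lin: "linear (\<lambda>v. m (v # vs))"
    using multilinear_middle[OF Suc.prems(1), of "[]" vs] us by simp
  have "m us = m ((\<Sum>b\<in>Basis. (u \<bullet> b) *\<^sub>R b) # vs)"
    by (simp add: us euclidean_representation)
  also have "\<dots> = (\<Sum>b\<in>Basis. (u \<bullet> b) * m (b # vs))"
    by (simp add: linear_sum[OF lin] linear_cmul[OF lin] o_def)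
  also have "\<dots> = (\<Sum>b\<in>Basis. (u \<bullet> b) *
      (\<Sum>bs\<in>basis_lists k. (\<Prod>i<k. vs ! i \<bullet> bs ! i) * m (b # bs)))"
    using Suc.IH[OF multilinear_Cons[OF Suc.prems(1)] us(2)] by simp
  also have "\<dots> = (\<Sum>b\<in>Basis. \<Sum>bs\<in>basis_lists k.
      (\<Prod>i<Suc k. (u # vs) ! i \<bullet> (b # bs) ! i) * m (b # bs))"
    by (simp add: prod.lessThan_Suc_shift sum_distrib_left mult.assoc del: prod.lessThan_Suc)
  also have "\<dots> = (\<Sum>(bs, b)\<in>basis_lists k \<times> Basis.
      (\<Prod>i<Suc k. (u # vs) ! i \<bullet> (b # bs) ! i) * m (b # bs))"
    by (subst sum.swap) (simp add: sum.cartesian_product)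
  also have "\<dots> = (\<Sum>bs\<in>basis_lists (Suc k). (\<Prod>i<Suc k. us ! i \<bullet> bs ! i) * m bs)"
    unfolding lists_length_Suc_eq us
    by (subst sum.reindex) (auto simp: inj_on_def case_prod_beta intro!: sum.cong)
  finally show ?case .
qed


section \<open>Gram determinants and orthogonalisation\<close>

text \<open>The determinant of the matrix \<open>g (u\<^sub>i) (w\<^sub>j)\<close>. Keeping the two lists separate makes it an
  alternating function of each of them; on the diagonal it is the Gram determinant.\<close>
definition cross_gram :: "('v \<Rightarrow> 'v \<Rightarrow> real) \<Rightarrow> 'v list \<Rightarrow> 'v list \<Rightarrow> real" where
  "cross_gram g us ws = (\<Sum>\<pi> | \<pi> permutes {..<length us}.
     of_int (sign \<pi>) * (\<Prod>i<length us. g (us ! i) (ws ! \<pi> i)))"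

text \<open>Linearity in slot \<open>j\<close>: each summand contains exactly one factor with \<open>w\<^sub>j\<close>, that of the row
  \<open>inv \<pi> j\<close>. If two entries agree, composing with their transposition pairs off the summands with
  opposite signs.\<close>
lemma cross_gram_alternating_right:
  assumes g: "\<And>u. linear (g u)" and us: "length us = k"
  shows "alternating k (cross_gram g us)"
  unfolding alternating_def multilinear_def
proof (intro conjI allI impI; (elim conjE)?)
  fix ws :: "'a list" and j assume ws: "length ws = k" "j < k"
  have split: "(\<Prod>i<k. g (us ! i) (ws[j := v] ! \<pi> i)) =
      g (us ! inv \<pi> j) v * (\<Prod>i\<in>{..<k} - {inv \<pi> j}. g (us ! i) (ws ! \<pi> i))"
    if "\<pi> permutes {..<k}" for \<pi> v
  proof -
    have "inv \<pi> j < k" using permutes_in_image[OF permutes_inv[OF that], of j] ws by simp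
    then have "(\<Prod>i<k. g (us ! i) (ws[j := v] ! \<pi> i)) = g (us ! inv \<pi> j) (ws[j := v] ! \<pi> (inv \<pi> j)) *
        (\<Prod>i\<in>{..<k} - {inv \<pi> j}. g (us ! i) (ws[j := v] ! \<pi> i))"
      by (intro prod.remove) auto
    also have "ws[j := v] ! \<pi> (inv \<pi> j) = v"
      using ws by (simp add: permutes_inverses[OF that])
    also have "(\<Prod>i\<in>{..<k} - {inv \<pi> j}. g (us ! i) (ws[j := v] ! \<pi> i)) =
        (\<Prod>i\<in>{..<k} - {inv \<pi> j}. g (us ! i) (ws ! \<pi> i))"
    proof (intro prod.cong refl)
      fix i assume "i \<in> {..<k} - {inv \<pi> j}"
      then have "\<pi> i \<noteq> j" using permutes_inverses[OF that] by auto
      then show "g (us ! i) (ws[j := v] ! \<pi> i) = g (us ! i) (ws ! \<pi> i)" by simp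
    qed
    finally show ?thesis .
  qed
  show "cross_gram g us (ws[j := v + w]) = cross_gram g us (ws[j := v]) +
      cross_gram g us (ws[j := w])" for v w
    unfolding cross_gram_def us sum.distrib[symmetric]
    by (intro sum.cong refl) (simp add: split linear_add[OF g] algebra_simps)
  show "cross_gram g us (ws[j := r *\<^sub>R v]) = r * cross_gram g us (ws[j := v])" for r v
    unfolding cross_gram_def us sum_distrib_left
    by (intro sum.cong refl) (simp add: split linear_cmul[OF g])
next
  fix ws :: "'a list" and i j assume ws: "length ws = k" "i < j" "j < k" "ws ! i = ws ! j"
  let ?\<tau> = "Transposition.transpose i j"
  let ?f = "\<lambda>\<pi>. of_int (sign \<pi>) * (\<Prod>l<k. g (us ! l) (ws ! \<pi> l))"
  have \<tau>: "?\<tau> permutes {..<k}" using ws by (intro permutes_swap_id) auto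
  have neg: "?f (?\<tau> \<circ> \<pi>) = - ?f \<pi>" if "\<pi> permutes {..<k}" for \<pi>
  proof -
    have "sign (?\<tau> \<circ> \<pi>) = - sign \<pi>"
      using ws that \<tau> by (subst sign_compose) (auto simp: sign_swap_id
          intro: permutes_imp_permutation[OF finite_lessThan])
    moreover have "ws ! (?\<tau> \<circ> \<pi>) l = ws ! \<pi> l" for l
      using ws by (auto simp: Transposition.transpose_def)
    ultimately show ?thesis by simp
  qed
  have "cross_gram g us ws = (\<Sum>\<pi> | \<pi> permutes {..<k}. ?f (?\<tau> \<circ> \<pi>))"
    unfolding cross_gram_def us by (rule setum_permutations_compose_left[OF \<tau>])
  also have "\<dots> = (\<Sum>\<pi> | \<pi> permutes {..<k}. - ?f \<pi>)"
    by (intro sum.cong refl neg) simp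
  also have "\<dots> = - cross_gram g us ws"
    by (simp add: cross_gram_def us sum_negf)
  finally show "cross_gram g us ws = 0" by simp
qed

lemma cross_gram_commute:
  assumes "\<And>u w. g u w = g w u" "length us = k" "length ws = k"
  shows "cross_gram g us ws = cross_gram g ws us"
proof -
  have "cross_gram g us ws = (\<Sum>\<pi> | \<pi> permutes {..<k}.
      of_int (sign (inv \<pi>)) * (\<Prod>i<k. g (us ! i) (ws ! inv \<pi> i)))"
    unfolding cross_gram_def assms(2,3) by (rule sum_permutations_inverse)
  also have "\<dots> = (\<Sum>\<pi> | \<pi> permutes {..<k}. of_int (sign \<pi>) * (\<Prod>i<k. g (ws ! i) (us ! \<pi> i)))"
  proof (intro sum.cong refl, drule CollectD)
    fix \<pi> :: "nat \<Rightarrow> nat" assume \<pi>: "\<pi> permutes {..<k}"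
    have "(\<Prod>i<k. g (us ! i) (ws ! inv \<pi> i)) = (\<Prod>i<k. g (us ! \<pi> i) (ws ! inv \<pi> (\<pi> i)))"
      using prod.permute[OF \<pi>, of "\<lambda>i. g (us ! i) (ws ! inv \<pi> i)"] by (simp add: o_def)
    also have "\<dots> = (\<Prod>i<k. g (ws ! i) (us ! \<pi> i))"
      by (simp add: permutes_inverses[OF \<pi>] assms(1)[of "us ! _"])
    finally show "of_int (sign (inv \<pi>)) * (\<Prod>i<k. g (us ! i) (ws ! inv \<pi> i)) =
        of_int (sign \<pi>) * (\<Prod>i<k. g (ws ! i) (us ! \<pi> i))"
      using permutes_imp_permutation[OF finite_lessThan \<pi>] by (simp add: sign_inverse)
  qed
  finally show ?thesis by (simp add: cross_gram_def assms(2,3))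
qed

lemma cross_gram_orthogonal:
  assumes "length us = k" "\<And>i j. i < k \<Longrightarrow> j < k \<Longrightarrow> i \<noteq> j \<Longrightarrow> g (us ! i) (us ! j) = 0"
  shows "cross_gram g us us = (\<Prod>i<k. g (us ! i) (us ! i))"
proof -
  have "of_int (sign \<pi>) * (\<Prod>i<k. g (us ! i) (us ! \<pi> i)) = 0"
    if \<pi>: "\<pi> permutes {..<k}" and "\<pi> \<noteq> id" for \<pi>
  proof -
    obtain i where "\<pi> i \<noteq> i" using \<open>\<pi> \<noteq> id\<close> by (auto simp: fun_eq_iff)
    then have "i < k" "\<pi> i < k"
      using \<pi> by (auto simp: permutes_def permutes_in_image[OF \<pi>, of i, simplified])
    then show ?thesis using assms(2)[of i "\<pi> i"] \<open>\<pi> i \<noteq> i\<close> by auto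
  qed
  then have "cross_gram g us us = (\<Sum>\<pi>\<in>{id}. of_int (sign \<pi>) * (\<Prod>i<k. g (us ! i) (us ! \<pi> i)))"
    unfolding cross_gram_def assms(1)
    by (intro sum.mono_neutral_right) (auto simp: finite_permutations permutes_id)
  then show ?thesis by simp
qed

text \<open>The Gram--Schmidt process only adds to each vector a combination of the earlier ones. It
  therefore preserves every alternating function, and also the Gram determinant, which is
  alternating in its rows and in its columns.\<close>
lemma gram_schmidt:
  fixes us :: "'v::real_vector list"
  assumes g: "\<And>u. linear (g u)" and sym: "\<And>u w. g u w = g w u"
    and pos: "\<And>u. u \<noteq> 0 \<Longrightarrow> g u u > 0" and "length us = k"
  obtains ws where "length ws = k" "\<And>i j. i < k \<Longrightarrow> j < k \<Longrightarrow> i \<noteq> j \<Longrightarrow> g (ws ! i) (ws ! j) = 0"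
    "\<And>m. alternating k m \<Longrightarrow> m ws = m us" "cross_gram g ws ws = cross_gram g us us"
proof -
  have "\<exists>ws. length ws = k \<and> (\<forall>i<n. \<forall>j<n. i \<noteq> j \<longrightarrow> g (ws ! i) (ws ! j) = 0) \<and>
      (\<forall>m. alternating k m \<longrightarrow> m ws = m us) \<and> cross_gram g ws ws = cross_gram g us us"
    if "n \<le> k" for n
    using that
  proof (induction n)
    case 0
    then show ?case using \<open>length us = k\<close> by auto
  next
    case (Suc n)
    then obtain ws where ws: "length ws = k" "\<And>i j. i < n \<Longrightarrow> j < n \<Longrightarrow> i \<noteq> j \<Longrightarrow> g (ws ! i) (ws ! j) = 0"
      "\<And>m. alternating k m \<Longrightarrow> m ws = m us" "cross_gram g ws ws = cross_gram g us us"
      by auto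
    \<comment> \<open>if \<open>ws ! i = 0\<close>, the quotient is \<open>0\<close>, and no correction is needed\<close>
    define a where "a = (\<lambda>i. - (g (ws ! n) (ws ! i) / g (ws ! i) (ws ! i)))"
    define v where "v = ws ! n + (\<Sum>i<n. a i *\<^sub>R ws ! i)"
    have inv: "m (ws[n := v]) = m ws" if "alternating k m" for m
      unfolding v_def using Suc.prems ws by (intro alternating_add_combination[OF that]) auto
    have "cross_gram g (ws[n := v]) (ws[n := v]) = cross_gram g (ws[n := v]) ws"
      using ws by (intro inv cross_gram_alternating_right g) simp
    also have "\<dots> = cross_gram g ws (ws[n := v])"
      using ws sym by (intro cross_gram_commute[of g _ k]) auto
    also have "\<dots> = cross_gram g ws ws"
      using ws by (intro inv cross_gram_alternating_right g) simp
    finally have gram: "cross_gram g (ws[n := v]) (ws[n := v]) = cross_gram g us us"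
      using ws by simp
    have orth: "g (ws ! i) v = 0" if "i < n" for i
    proof -
      have "g (ws ! i) v = g (ws ! i) (ws ! n) + (\<Sum>l<n. a l * g (ws ! i) (ws ! l))"
        by (simp add: v_def linear_add[OF g] linear_sum[OF g] linear_cmul[OF g] o_def)
      also have "(\<Sum>l<n. a l * g (ws ! i) (ws ! l)) = (\<Sum>l\<in>{i}. a l * g (ws ! i) (ws ! l))"
        using ws(2) that by (intro sum.mono_neutral_right) auto
      also have "g (ws ! i) (ws ! n) + \<dots> = 0"
      proof (cases "ws ! i = 0")
        case True
        then show ?thesis using sym[of "ws ! i" "ws ! n"] linear_0[OF g] by simp
      next
        case False
        then have "g (ws ! i) (ws ! i) \<noteq> 0" using pos[OF False] by simp
        then show ?thesis using sym[of "ws ! i" "ws ! n"] by (simp add: a_def)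
      qed
      finally show ?thesis .
    qed
    have orth': "g (ws[n := v] ! i) (ws[n := v] ! j) = 0" if "i < Suc n" "j < Suc n" "i \<noteq> j" for i j
      using that orth sym ws Suc.prems by (cases "i = n"; cases "j = n") (auto simp: less_Suc_eq)
    have "m (ws[n := v]) = m us" if "alternating k m" for m
      using inv[OF that] ws(3)[OF that] by simp
    then show ?case
      using ws(1) orth' gram by (intro exI[of _ "ws[n := v]"] conjI allI impI) simp_all
  qed
  from this[OF order_refl] obtain ws where "length ws = k"
    "\<forall>i<k. \<forall>j<k. i \<noteq> j \<longrightarrow> g (ws ! i) (ws ! j) = 0"
    "\<forall>m. alternating k m \<longrightarrow> m ws = m us" "cross_gram g ws ws = cross_gram g us us"
    by (elim exE conjE)
  then show thesis by (intro that[of ws]) simp_all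
qed

text \<open>After orthogonalisation the Gram determinant is the product of the squared \<open>g\<close>-lengths, so
  it controls the product of the Euclidean lengths in the expansion along the standard basis.\<close>
lemma alternating_bound_gram:
  fixes us :: "'v::euclidean_space list"
  assumes g: "\<And>u. linear (g u)" and sym: "\<And>u w. g u w = g w u"
    and "c > 0" and lower: "\<And>u. g u u \<ge> c * (norm u)\<^sup>2"
    and us: "length us = k" "cross_gram g us us = 1"
    and m: "alternating k m" "\<And>bs. bs \<in> basis_lists k \<Longrightarrow> \<bar>m bs\<bar> \<le> r" and "r \<ge> 0"
  shows "\<bar>m us\<bar> \<le> real (card (basis_lists k :: 'v list set)) * sqrt (1 / c ^ k) * r"
proof -
  have pos: "g u u > 0" if "u \<noteq> 0" for u
    using lower[of u] \<open>c > 0\<close> that by (smt (verit) mult_pos_pos zero_less_norm_iff zero_less_power)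
  obtain ws where ws: "length ws = k" "\<And>i j. i < k \<Longrightarrow> j < k \<Longrightarrow> i \<noteq> j \<Longrightarrow> g (ws ! i) (ws ! j) = 0"
    "m ws = m us" "cross_gram g ws ws = 1"
    using gram_schmidt[OF g sym pos us(1)] m(1) us(2) by metis
  have "c ^ k * (\<Prod>i<k. norm (ws ! i))\<^sup>2 = (\<Prod>i<k. c * (norm (ws ! i))\<^sup>2)"
    by (simp add: prod.distrib prod_power_distrib)
  also have "\<dots> \<le> (\<Prod>i<k. g (ws ! i) (ws ! i))"
    using lower \<open>c > 0\<close> by (intro prod_mono) auto
  also have "\<dots> = 1" using cross_gram_orthogonal[of ws k g] ws by simp
  finally have "(\<Prod>i<k. norm (ws ! i))\<^sup>2 \<le> 1 / c ^ k"
    using \<open>c > 0\<close> by (simp add: field_simps)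
  then have len: "(\<Prod>i<k. norm (ws ! i)) \<le> sqrt (1 / c ^ k)"
    by (rule real_le_rsqrt)
  have "\<bar>m ws\<bar> \<le> (\<Sum>bs\<in>basis_lists k. \<bar>(\<Prod>i<k. ws ! i \<bullet> bs ! i) * m bs\<bar>)"
    unfolding multilinear_expansion[OF alternating_imp_multilinear[OF m(1)] ws(1)]
    by (rule sum_abs)
  also have "\<dots> \<le> (\<Sum>bs\<in>(basis_lists k :: 'v list set). sqrt (1 / c ^ k) * r)"
  proof (intro sum_mono)
    fix bs :: "'v list" assume bs: "bs \<in> basis_lists k"
    have "\<bar>\<Prod>i<k. ws ! i \<bullet> bs ! i\<bar> \<le> (\<Prod>i<k. norm (ws ! i))"
      unfolding abs_prod
    proof (intro prod_mono conjI)
      fix i assume "i \<in> {..<k}"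
      then have "bs ! i \<in> Basis" using bs nth_mem by fastforce
      then show "\<bar>ws ! i \<bullet> bs ! i\<bar> \<le> norm (ws ! i)" by (rule Basis_le_norm)
    qed simp
    then show "\<bar>(\<Prod>i<k. ws ! i \<bullet> bs ! i) * m bs\<bar> \<le> sqrt (1 / c ^ k) * r"
      unfolding abs_mult using len m(2)[OF bs] \<open>c > 0\<close> by (intro mult_mono) auto
  qed
  finally show ?thesis using ws(3) by (simp add: mult.assoc)
qed


section \<open>The exterior derivative in coordinates\<close>

abbreviation omit :: "nat \<Rightarrow> 'b list \<Rightarrow> 'b list" where
  "omit i xs \<equiv> take i xs @ drop (Suc i) xs"

text \<open>The formula for \<open>d\<close> of the form on a vector space whose component along constant vectors \<open>us\<close>
  is \<open>G us\<close>.\<close>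
definition coord_d :: "('v::real_normed_vector list \<Rightarrow> 'v \<Rightarrow> real) \<Rightarrow> 'v list \<Rightarrow> 'v \<Rightarrow> real" where
  "coord_d G us y =
     (\<Sum>i<length us. (-1) ^ i * frechet_derivative (G (omit i us)) (at y) (us ! i))"

lemma nth_omit:
  "i < length us \<Longrightarrow> j < length us - 1 \<Longrightarrow> omit i us ! j = us ! (if j < i then j else Suc j)"
  by (auto simp: nth_append min_def)

lemma split_at_two:
  assumes "i < j" "j < length us"
  obtains xs ys zs where "us = xs @ us ! i # ys @ us ! j # zs" "length xs = i" "Suc (i + length ys)
      = j"
proof
  let ?r = "drop (Suc i) us"
  have "?r = take (j - Suc i) ?r @ ?r ! (j - Suc i) # drop (Suc (j - Suc i)) ?r"
    using assms by (intro id_take_nth_drop) auto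
  moreover have "us = take i us @ us ! i # ?r"
    using assms by (intro id_take_nth_drop) auto
  ultimately show "us = take i us @ us ! i # take (j - Suc i) ?r @ us ! j # drop (Suc (j - Suc i)) ?r"
    using assms by simp
qed (use assms in auto)

text \<open>Removing the first of two designated entries and removing the second one, after putting the
  same vector into the remaining place, gives two lists that differ by a cyclic shift.\<close>
lemma alternating_omit_exchange:
  assumes m: "alternating k m" and us: "length us = Suc k" "i < j" "j < Suc k"
  shows "(-1) ^ i * m (omit i (us[j := x])) = - ((-1) ^ j * m (omit j (us[i := x])))"
proof -
  obtain xs ys zs where s: "us = xs @ us ! i # ys @ us ! j # zs" "length xs = i"
      "Suc (i + length ys) = j"
    using split_at_two[of i j us] us by auto
  define a b where "a = us ! i" and "b = us ! j"
  have s': "us = xs @ a # ys @ b # zs" using s(1) by (simp add: a_def b_def)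
  have len: "length xs + length ys + length zs + 1 = k" using us(1) s' by simp
  have "us[j := x] = xs @ a # ys @ x # zs"
    unfolding s' s(3)[symmetric] s(2)[symmetric] by (simp add: list_update_append)
  then have 1: "omit i (us[j := x]) = xs @ ys @ x # zs"
    using s(2) by simp
  have "us[i := x] = xs @ x # ys @ b # zs"
    unfolding s' s(2)[symmetric] by (simp add: list_update_append)
  then have 2: "omit j (us[i := x]) = xs @ x # ys @ zs"
    using s(2,3) by auto
  have "(-1) ^ j * m (omit j (us[i := x])) = (-1) ^ j * ((-1) ^ length ys * m (xs @ ys @ x # zs))"
    unfolding 2 using alternating_move[OF m len] by simp
  also have "\<dots> = - ((-1) ^ i * m (xs @ ys @ x # zs))"
    unfolding s(3)[symmetric] by (simp add: power_add flip: mult.assoc power_mult_distrib)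
  finally show ?thesis unfolding 1 by simp
qed

lemma alternating_derivative:
  fixes G :: "'v::real_normed_vector list \<Rightarrow> 'v \<Rightarrow> real"
  assumes U: "open U" "y \<in> U" and G: "\<And>z. z \<in> U \<Longrightarrow> alternating k (\<lambda>us. G us z)"
    and diff: "\<And>us. length us = k \<Longrightarrow> G us differentiable (at y)"
  shows "alternating k (\<lambda>us. frechet_derivative (G us) (at y) u)"
  unfolding alternating_def multilinear_def
proof (intro conjI allI impI; (elim conjE)?)
  fix us :: "'v list" and i assume us: "length us = k" "i < k"
  note D = diff[unfolded frechet_derivative_works]
  show "frechet_derivative (G (us[i := v + w])) (at y) u =
      frechet_derivative (G (us[i := v])) (at y) u + frechet_derivative (G (us[i := w])) (at y) u"
          for v w
  proof -
    have "frechet_derivative (G (us[i := v + w])) (at y) =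
        frechet_derivative (\<lambda>z. G (us[i := v]) z + G (us[i := w]) z) (at y)"
      using G us by (intro frechet_derivative_cong_open[OF U])
          (simp add: alternating_def multilinear_def)
    also have "\<dots> = (\<lambda>u. frechet_derivative (G (us[i := v])) (at y) u +
        frechet_derivative (G (us[i := w])) (at y) u)"
      using us by (intro frechet_derivative_at[symmetric] has_derivative_add D) auto
    finally show ?thesis by simp
  qed
  show "frechet_derivative (G (us[i := r *\<^sub>R v])) (at y) u
      = r * frechet_derivative (G (us[i := v])) (at y) u" for r v
  proof -
    have "frechet_derivative (G (us[i := r *\<^sub>R v])) (at y)
        = frechet_derivative (\<lambda>z. r * G (us[i := v]) z) (at y)"
      using G us by (intro frechet_derivative_cong_open[OF U])
          (simp add: alternating_def multilinear_def)
    also have "\<dots> = (\<lambda>u. r * frechet_derivative (G (us[i := v])) (at y) u)"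
      using us by (intro frechet_derivative_at[symmetric] has_derivative_mult_right D) auto
    finally show ?thesis by simp
  qed
next
  fix us :: "'v list" and i j assume us: "length us = k" "i < j" "j < k" "us ! i = us ! j"
  have "frechet_derivative (G us) (at y) = frechet_derivative (\<lambda>_. 0) (at y)"
    using G us by (intro frechet_derivative_cong_open[OF U]) (auto simp: alternating_def)
  then show "frechet_derivative (G us) (at y) u = 0" by simp
qed

lemma linear_coord_d_term:
  assumes us: "length us = Suc k" "i < Suc k" "j < Suc k"
    and D: "\<And>u. multilinear k (\<lambda>us. D us u)" "\<And>us. length us = k \<Longrightarrow> linear (D us)"
  shows "linear (\<lambda>v. D (omit i (us[j := v])) (us[j := v] ! i))"
proof (cases "i = j")
  case True
  then have "omit i (us[j := v]) = omit i us" for v by simp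
  then show ?thesis using us True D(2)[of "omit i us"] by simp
next
  case False
  define l where "l = (if j < i then j else j - 1)"
  have "omit i (us[j := v]) = (omit i us)[l := v]" for v
    using us False by (intro nth_equalityI) (auto simp: nth_omit nth_list_update l_def)
  moreover have "linear (\<lambda>v. D ((omit i us)[l := v]) (us ! i))"
    using us False by (intro multilinear_slot[OF D(1)]) (auto simp: l_def)
  ultimately show ?thesis using False by simp
qed

text \<open>If \<open>u\<^sub>i = u\<^sub>j\<close>, every term that keeps both of them vanishes, and the two remaining terms differ by
  a shift and cancel.\<close>
lemma coord_d_alternating:
  fixes G :: "'v::real_normed_vector list \<Rightarrow> 'v \<Rightarrow> real"
  assumes U: "open U" "y \<in> U" and G: "\<And>z. z \<in> U \<Longrightarrow> alternating k (\<lambda>us. G us z)"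
    and diff: "\<And>us. length us = k \<Longrightarrow> G us differentiable (at y)"
  shows "alternating (Suc k) (\<lambda>us. coord_d G us y)"
proof -
  define D where "D = (\<lambda>us u. frechet_derivative (G us) (at y) u)"
  have alt: "alternating k (\<lambda>us. D us u)" for u
    unfolding D_def by (rule alternating_derivative[OF U G diff])
  have lin: "linear (D us)" if "length us = k" for us
    unfolding D_def using linear_frechet_derivative[OF diff[OF that]] by simp
  have cd: "coord_d G us y = (\<Sum>i<Suc k. (-1) ^ i * D (omit i us) (us ! i))" if "length us = Suc k"
      for us
    using that by (simp add: coord_d_def D_def)
  have slot: "linear (\<lambda>v. coord_d G (us[j := v]) y)" if "length us = Suc k" "j < Suc k" for us j
  proof -
    have "linear (\<lambda>v. (-1) ^ i * D (omit i (us[j := v])) (us[j := v] ! i))" if "i < Suc k" for i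
      using linear_coord_d_term[OF \<open>length us = Suc k\<close> that \<open>j < Suc k\<close>
          alternating_imp_multilinear[OF alt] lin]
      by (simp add: linear_iff algebra_simps)
    then have "linear (\<lambda>v. \<Sum>i<Suc k. (-1) ^ i * D (omit i (us[j := v])) (us[j := v] ! i))"
      by (intro linear_compose_sum) auto
    then show ?thesis using that by (simp add: cd)
  qed
  show ?thesis
    unfolding alternating_def multilinear_def
  proof (intro conjI allI impI; (elim conjE)?)
    fix us :: "'v list" and j assume "length us = Suc k" "j < Suc k"
    note slot[OF this]
    then show "coord_d G (us[j := v + w]) y = coord_d G (us[j := v]) y + coord_d G (us[j := w]) y"
      "coord_d G (us[j := r *\<^sub>R v]) y = r * coord_d G (us[j := v]) y" for v w r
      by (simp_all add: linear_iff)
  next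
    fix us :: "'v list" and i j assume us: "length us = Suc k" "i < j" "j < Suc k" "us ! i = us ! j"
    have zero: "D (omit l us) u = 0" if "l < Suc k" "l \<noteq> i" "l \<noteq> j" for l u
    proof (rule alternating_repeat[OF alt])
      let ?c = "\<lambda>i. if i < l then i else i - 1"
      show "omit l us ! ?c i = omit l us ! ?c j"
        using us that by (auto simp: nth_omit)
    qed (use us that in auto)
    have "us[j := us ! i] = us" "us[i := us ! i] = us" using us(4) by (metis list_update_id)+
    then have "(-1) ^ i * D (omit i us) (us ! i) = - ((-1) ^ j * D (omit j us) (us ! j))"
      using alternating_omit_exchange[OF alt us(1-3), of "us ! i" "us ! i"] us(4) by simp
    moreover have "coord_d G us y = (\<Sum>l\<in>{i, j}. (-1) ^ l * D (omit l us) (us ! l))"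
      unfolding cd[OF us(1)] using us zero by (intro sum.mono_neutral_right) auto
    ultimately show "coord_d G us y = 0" using us(2) by simp
  qed
qed

text \<open>The terms with the second derivative of a change of coordinates cancel in pairs: exchanging
  the index of the differentiated entry with the index of the direction changes the sign.\<close>
lemma symmetric_part_cancels:
  assumes m: "alternating k m" and us: "length us = Suc k"
    and R: "\<And>i l. R i l = R l i"
  shows "(\<Sum>i<Suc k. (-1) ^ i * (\<Sum>j<k. m ((omit i us)[j := R i (if j < i then j else Suc j)]))) = 0"
proof -
  define s where "s = (\<lambda>i l. if l = i then 0 else (-1) ^ i * m (omit i (us[l := R i l])))"
  have anti: "s i l = - s l i" if "i < Suc k" "l < Suc k" for i l
    using alternating_omit_exchange[OF m us, of i l "R i l"]
      alternating_omit_exchange[OF m us, of l i "R i l"] that R[of l i]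
    by (cases i l rule: linorder_cases) (auto simp: s_def)
  have "(-1) ^ i * (\<Sum>j<k. m ((omit i us)[j := R i (if j < i then j else Suc j)])) = (\<Sum>l<Suc k. s i l)"
    if i: "i < Suc k" for i
  proof -
    let ?skip = "\<lambda>j. if j < i then j else Suc j"
    have "(omit i us)[j := x] = omit i (us[?skip j := x])" if "j < k" for j x
      using us i that by (intro nth_equalityI) (auto simp: nth_omit nth_list_update)
    then have "(-1) ^ i * (\<Sum>j<k. m ((omit i us)[j := R i (?skip j)])) = (\<Sum>j<k. s i (?skip j))"
      unfolding sum_distrib_left by (intro sum.cong refl) (auto simp: s_def)
    also have "\<dots> = (\<Sum>l\<in>{..<Suc k} - {i}. s i l)"
    proof (rule sum.reindex_bij_betw)
      show "bij_betw ?skip {..<k} ({..<Suc k} - {i})"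
        by (rule bij_betw_byWitness[where f' = "\<lambda>l. if l < i then l else l - 1"]) (use i in auto)
    qed
    also have "\<dots> = (\<Sum>l<Suc k. s i l)"
      by (intro sum.mono_neutral_left) (auto simp: s_def)
    finally show ?thesis .
  qed
  then have "(\<Sum>i<Suc k. (-1) ^ i * (\<Sum>j<k. m ((omit i us)[j := R i (if j < i then j else Suc j)]))) =
      (\<Sum>i<Suc k. \<Sum>l<Suc k. s i l)"
    by (intro sum.cong) auto
  moreover have "(\<Sum>i<Suc k. \<Sum>l<Suc k. s i l) = - (\<Sum>i<Suc k. \<Sum>l<Suc k. s i l)"
  proof -
    have "(\<Sum>i<Suc k. \<Sum>l<Suc k. s i l) = (\<Sum>i<Suc k. \<Sum>l<Suc k. s l i)"
      by (rule sum.swap)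
    also have "\<dots> = (\<Sum>i<Suc k. \<Sum>l<Suc k. - s i l)"
      by (intro sum.cong refl anti) auto
    also have "\<dots> = - (\<Sum>i<Suc k. \<Sum>l<Suc k. s i l)"
      by (simp only: sum_negf)
    finally show ?thesis .
  qed
  ultimately show ?thesis by simp
qed

text \<open>Expanding \<open>G\<close> along the standard basis turns the pulled-back component into a finite sum of
  products. The product rule then separates the derivative of the coefficients of \<open>G\<close> from the
  derivatives of the Jacobian that occupies each slot.\<close>
lemma derivative_pullback:
  fixes G :: "'v::euclidean_space list \<Rightarrow> 'v \<Rightarrow> real" and \<tau> :: "'v \<Rightarrow> 'v"
  defines "A \<equiv> \<lambda>z. frechet_derivative \<tau> (at z)"
  assumes U: "open U" "y \<in> U" and V: "open V" "\<tau> ` U \<subseteq> V" and \<tau>: "smooth_on U \<tau>"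
    and G: "\<And>z. z \<in> V \<Longrightarrow> alternating k (\<lambda>us. G us z)"
    and diff: "\<And>us. length us = k \<Longrightarrow> G us differentiable (at (\<tau> y))"
    and F: "\<And>z. z \<in> U \<Longrightarrow> F z = G (map (A z) ws) (\<tau> z)" and ws: "length ws = k"
  shows "frechet_derivative F (at y) u =
     frechet_derivative (G (map (A y) ws)) (at (\<tau> y)) (A y u) +
     (\<Sum>j<k. G ((map (A y) ws)[j := frechet_derivative (\<lambda>z. A z (ws ! j)) (at y) u]) (\<tau> y))"
proof -
  have \<tau>y: "\<tau> y \<in> V" using U V by auto
  define Q where "Q = (\<lambda>j u. frechet_derivative (\<lambda>z. A z (ws ! j)) (at y) u)"
  define P where "P = (\<lambda>bs z. \<Prod>j<k. A z (ws ! j) \<bullet> bs ! j)"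
  have expF: "F z = (\<Sum>bs\<in>basis_lists k. P bs z * G bs (\<tau> z))" if "z \<in> U" for z
  proof -
    have "\<tau> z \<in> V" using V that by auto
    then show ?thesis
      unfolding F[OF that] P_def
      using multilinear_expansion[OF alternating_imp_multilinear[OF G], of "\<tau> z" "map (A z) ws"] ws
      by simp
  qed
  have dA: "((\<lambda>z. A z (ws ! j) \<bullet> b) has_derivative (\<lambda>u. Q j u \<bullet> b)) (at y)" for j b
    unfolding Q_def A_def using \<tau> U
    by (intro has_derivative_inner_left iffD1[OF frechet_derivative_works]
        smooth_on_imp_differentiable[of U] smooth_on_frechet_derivative)
  have dP: "(P bs has_derivative (\<lambda>u. \<Sum>j<k. (Q j u \<bullet> bs ! j) *
      (\<Prod>i\<in>{..<k} - {j}. A y (ws ! i) \<bullet> bs ! i))) (at y)" for bs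
    unfolding P_def by (rule has_derivative_prod) (rule dA)
  have dG: "((\<lambda>z. G bs (\<tau> z)) has_derivative (\<lambda>u. frechet_derivative (G bs) (at (\<tau> y)) (A y u))) (at y)"
    if "bs \<in> basis_lists k" for bs
    unfolding A_def
    by (rule has_derivative_compose
        [OF iffD1[OF frechet_derivative_works smooth_on_imp_differentiable[OF \<tau> U(2)]]
          iffD1[OF frechet_derivative_works diff]]) (use that in simp)
  have "((\<lambda>z. \<Sum>bs\<in>basis_lists k. P bs z * G bs (\<tau> z)) has_derivative
      (\<lambda>u. \<Sum>bs\<in>basis_lists k. P bs y * frechet_derivative (G bs) (at (\<tau> y)) (A y u) +
        (\<Sum>j<k. (Q j u \<bullet> bs ! j) * (\<Prod>i\<in>{..<k} - {j}. A y (ws ! i) \<bullet> bs ! i)) * G bs (\<tau> y))) (at y)"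
    by (intro has_derivative_sum has_derivative_mult dP dG)
  then have "(F has_derivative
      (\<lambda>u. \<Sum>bs\<in>basis_lists k. P bs y * frechet_derivative (G bs) (at (\<tau> y)) (A y u) +
        (\<Sum>j<k. (Q j u \<bullet> bs ! j) * (\<Prod>i\<in>{..<k} - {j}. A y (ws ! i) \<bullet> bs ! i)) * G bs (\<tau> y))) (at y)"
    by (rule has_derivative_transform_within_open[OF _ U]) (simp add: expF)
  from frechet_derivative_at[OF this, symmetric]
  have "frechet_derivative F (at y) u =
      (\<Sum>bs\<in>basis_lists k. P bs y * frechet_derivative (G bs) (at (\<tau> y)) (A y u)) +
      (\<Sum>bs\<in>basis_lists k. \<Sum>j<k. (Q j u \<bullet> bs ! j) * (\<Prod>i\<in>{..<k} - {j}. A y (ws ! i) \<bullet> bs ! i)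
          * G bs (\<tau> y))"
    by (simp add: sum.distrib sum_distrib_right)
  moreover have "(\<Sum>bs\<in>basis_lists k. P bs y * frechet_derivative (G bs) (at (\<tau> y)) (A y u)) =
      frechet_derivative (G (map (A y) ws)) (at (\<tau> y)) (A y u)"
    using multilinear_expansion[OF alternating_imp_multilinear[OF alternating_derivative[OF V(1) \<tau>y G diff]],
        of "map (A y) ws" "A y u"] ws
    by (simp add: P_def)
  moreover have "(\<Sum>bs\<in>basis_lists k. (Q j u \<bullet> bs ! j) * (\<Prod>i\<in>{..<k} - {j}. A y (ws ! i) \<bullet> bs ! i)
      * G bs (\<tau> y)) =
      G ((map (A y) ws)[j := Q j u]) (\<tau> y)" if "j < k" for j
  proof -
    have "(\<Prod>i<k. (map (A y) ws)[j := Q j u] ! i \<bullet> bs ! i) =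
        (Q j u \<bullet> bs ! j) * (\<Prod>i\<in>{..<k} - {j}. A y (ws ! i) \<bullet> bs ! i)" for bs
      using that ws by (subst prod.remove[of _ j]) (auto intro!: prod.cong)
    then show ?thesis
      using multilinear_expansion[OF alternating_imp_multilinear[OF G[OF \<tau>y]],
          of "(map (A y) ws)[j := Q j u]"] ws by simp
  qed
  ultimately show ?thesis
    by (subst (asm) sum.swap) (simp add: Q_def)
qed

text \<open>The second derivative of the coordinate change is symmetric, so its contribution cancels, and
  exterior differentiation commutes with pullback.\<close>
lemma coord_d_pullback:
  fixes G :: "'v::euclidean_space list \<Rightarrow> 'v \<Rightarrow> real" and \<tau> :: "'v \<Rightarrow> 'v"
  defines "A \<equiv> \<lambda>z. frechet_derivative \<tau> (at z)"
  assumes U: "open U" "y \<in> U" and V: "open V" "\<tau> ` U \<subseteq> V" and \<tau>: "smooth_on U \<tau>"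
    and G: "\<And>z. z \<in> V \<Longrightarrow> alternating k (\<lambda>us. G us z)"
    and diff: "\<And>us. length us = k \<Longrightarrow> G us differentiable (at (\<tau> y))"
    and F: "\<And>z ws. z \<in> U \<Longrightarrow> length ws = k \<Longrightarrow> F ws z = G (map (A z) ws) (\<tau> z)"
    and us: "length us = Suc k"
  shows "coord_d F us y = coord_d G (map (A y) us) (\<tau> y)"
proof -
  have \<tau>y: "\<tau> y \<in> V" using U V by auto
  define R where "R = (\<lambda>i l. frechet_derivative (\<lambda>z. A z (us ! l)) (at y) (us ! i))"
  have R: "R i l = R l i" for i l
    unfolding R_def A_def by (rule mixed_derivatives_commute[OF U(1) \<tau> U(2)])
  have omit_map: "map (A y) (omit i us) = omit i (map (A y) us)" for i
    by (simp add: take_map drop_map)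
  have "frechet_derivative (F (omit i us)) (at y) (us ! i) =
      frechet_derivative (G (omit i (map (A y) us))) (at (\<tau> y)) (map (A y) us ! i) +
      (\<Sum>j<k. G ((omit i (map (A y) us))[j := R i (if j < i then j else Suc j)]) (\<tau> y))"
    if i: "i < Suc k" for i
  proof -
    have len: "length (omit i us) = k" using us i by simp
    have "frechet_derivative (F (omit i us)) (at y) (us ! i) =
       frechet_derivative (G (map (A y) (omit i us))) (at (\<tau> y)) (A y (us ! i)) +
       (\<Sum>j<k. G ((map (A y) (omit i us))[j := frechet_derivative (\<lambda>z. A z (omit i us ! j)) (at y) (us ! i)]) (\<tau> y))"
      unfolding A_def
      by (rule derivative_pullback[OF U V \<tau> G diff _ len]) (use F len in \<open>auto simp: A_def\<close>)
    also have "(\<Sum>j<k. G ((map (A y) (omit i us))[j := frechet_derivative (\<lambda>z. A z (omit i us ! j)) (at y) (us ! i)]) (\<tau> y)) =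
       (\<Sum>j<k. G ((omit i (map (A y) us))[j := R i (if j < i then j else Suc j)]) (\<tau> y))"
      unfolding omit_map R_def using us i by (intro sum.cong refl) (simp add: nth_omit)
    finally show ?thesis using us i by (simp add: omit_map del: map_append)
  qed
  then have "coord_d F us y = coord_d G (map (A y) us) (\<tau> y) +
      (\<Sum>i<Suc k. (-1) ^ i * (\<Sum>j<k. G ((omit i (map (A y) us))[j := R i (if j < i then j else Suc j)]) (\<tau> y)))"
    unfolding coord_d_def length_map us sum.distrib[symmetric]
    by (intro sum.cong refl) (simp add: distrib_left)
  also have "(\<Sum>i<Suc k. (-1) ^ i * (\<Sum>j<k.
      G ((omit i (map (A y) us))[j := R i (if j < i then j else Suc j)]) (\<tau> y))) = 0"
    using us R by (intro symmetric_part_cancels[OF G[OF \<tau>y]]) auto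
  finally show ?thesis by simp
qed


section \<open>Charts and tangent vectors\<close>

locale manifold =
  fixes M :: "('a, 'n::finite) riem_space"
  assumes mfd: "oriented_manifold M"
begin

abbreviation jac :: "('a, 'n) chart \<Rightarrow> ('a, 'n) chart \<Rightarrow> real ^ 'n \<Rightarrow> real ^ 'n \<Rightarrow> real ^ 'n" where
  "jac c c' y \<equiv> frechet_derivative (transition c c') (at y)"

lemma
  assumes "c \<in> atlas M"
  shows openin_chart: "openin (underlying M) (fst c)"
    and open_chart_img: "open (chart_img c)"
    and homeomorphic_chart:
      "homeomorphic_map (subtopology (underlying M) (fst c)) (top_of_set (chart_img c)) (snd c)"
  using mfd assms by (auto simp: oriented_manifold_def is_chart_def)

lemma chart_subset: "c \<in> atlas M \<Longrightarrow> fst c \<subseteq> points M"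
  using openin_chart openin_subset by blast

lemma chart_inj: "c \<in> atlas M \<Longrightarrow> inj_on (snd c) (fst c)"
  using homeomorphic_chart[of c] chart_subset[of c]
  by (auto simp: homeomorphic_map_def dest!: homeomorphic_imp_injective_map simp: Int_absorb1)

lemma charts_atD: "c \<in> charts_at M x \<Longrightarrow> c \<in> atlas M" "c \<in> charts_at M x \<Longrightarrow> x \<in> fst c"
  by (simp_all add: charts_at_def)

lemma charts_at_points: "c \<in> charts_at M x \<Longrightarrow> x \<in> points M"
  using chart_subset[of c] by (auto simp: charts_at_def)

lemma charts_at_nonempty: "x \<in> points M \<Longrightarrow> \<exists>c. c \<in> charts_at M x"
  using mfd unfolding oriented_manifold_def charts_at_def by blast

lemma chart_inv_chart: "c \<in> charts_at M x \<Longrightarrow> chart_inv c (snd c x) = x"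
  using chart_inj by (auto simp: chart_inv_def charts_at_def)

lemma chart_in_img: "c \<in> charts_at M x \<Longrightarrow> snd c x \<in> chart_img c"
  by (auto simp: chart_img_def charts_at_def)

lemma
  assumes "c \<in> atlas M" "y \<in> chart_img c"
  shows chart_inv_charts_at: "c \<in> charts_at M (chart_inv c y)"
    and chart_chart_inv: "snd c (chart_inv c y) = y"
    and chart_inv_points: "chart_inv c y \<in> points M"
proof -
  show "c \<in> charts_at M (chart_inv c y)" "snd c (chart_inv c y) = y"
    using assms by (auto simp: chart_inv_def chart_img_def charts_at_def inv_into_into f_inv_into_f)
  then show "chart_inv c y \<in> points M"
    using chart_subset[OF assms(1)] by (auto simp: charts_at_def)
qed

lemma open_chart_image:
  assumes "c \<in> atlas M" "openin (underlying M) W" "W \<subseteq> fst c"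
  shows "open (snd c ` W)"
proof -
  have "openin (subtopology (underlying M) (fst c)) W"
    using assms by (simp add: openin_subset_topspace_eq openin_open_subtopology openin_chart)
  then have "openin (top_of_set (chart_img c)) (snd c ` W)"
    using homeomorphic_imp_open_map[OF homeomorphic_chart[OF assms(1)]] by (simp add: open_map_def)
  then show ?thesis using openin_open_trans open_chart_img[OF assms(1)] by blast
qed

abbreviation overlap :: "('a, 'n) chart \<Rightarrow> ('a, 'n) chart \<Rightarrow> (real ^ 'n) set" where
  "overlap c c' \<equiv> snd c ` (fst c \<inter> fst c')"

lemma open_overlap: "c \<in> atlas M \<Longrightarrow> c' \<in> atlas M \<Longrightarrow> open (overlap c c')"
  by (intro open_chart_image openin_Int openin_chart) auto

lemma smooth_transition:
  "c \<in> atlas M \<Longrightarrow> c' \<in> atlas M \<Longrightarrow> smooth_on (overlap c c') (transition c c')"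
  using mfd by (auto simp: oriented_manifold_def)

lemma transition_chart:
  "c \<in> atlas M \<Longrightarrow> x \<in> fst c \<Longrightarrow> transition c c' (snd c x) = snd c' x"
  using chart_inv_chart by (auto simp: transition_def charts_at_def)

lemma transition_differentiable:
  "c \<in> charts_at M x \<Longrightarrow> c' \<in> charts_at M x \<Longrightarrow> transition c c' differentiable (at (snd c x))"
  by (rule smooth_on_imp_differentiable[OF smooth_transition]) (auto simp: charts_at_def)

lemma linear_jac: "c \<in> charts_at M x \<Longrightarrow> c' \<in> charts_at M x \<Longrightarrow> linear (jac c c' (snd c x))"
  by (rule linear_frechet_derivative[OF transition_differentiable])

lemma jac_self: "c \<in> charts_at M x \<Longrightarrow> jac c c (snd c x) = (\<lambda>u. u)"
proof -
  assume c: "c \<in> charts_at M x"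
  have "jac c c (snd c x) = frechet_derivative (\<lambda>z. z) (at (snd c x))"
    using c transition_chart[of c _ c]
    by (intro frechet_derivative_cong_open[of "chart_img c"] open_chart_img)
       (auto simp: charts_at_def chart_img_def)
  then show ?thesis by simp
qed

lemma jac_cocycle:
  assumes "c \<in> charts_at M x" "c' \<in> charts_at M x" "c'' \<in> charts_at M x"
  shows "jac c c'' (snd c x) u = jac c' c'' (snd c' x) (jac c c' (snd c x) u)"
proof -
  note at = assms[THEN charts_atD(1)] assms[THEN charts_atD(2)]
  let ?W = "fst c \<inter> fst c' \<inter> fst c''"
  have "jac c c'' (snd c x) = frechet_derivative (transition c' c'' \<circ> transition c c') (at (snd c x))"
  proof (rule frechet_derivative_cong_open)
    show "open (snd c ` ?W)" using at by (intro open_chart_image openin_Int openin_chart) auto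
    show "transition c c'' z = (transition c' c'' \<circ> transition c c') z" if "z \<in> snd c ` ?W" for z
      using that at by (auto simp: transition_chart)
  qed (use at in auto)
  also have "\<dots> = jac c' c'' (transition c c' (snd c x)) \<circ> jac c c' (snd c x)"
    using assms at by (intro frechet_derivative_compose transition_differentiable)
      (auto simp: transition_chart intro: transition_differentiable)
  finally show ?thesis using at by (simp add: transition_chart)
qed

lemma coord_vec_chart: "c' \<in> charts_at M x \<Longrightarrow> coord_vec M c x u c' = jac c c' (snd c x) u"
  by (simp add: coord_vec_def)

lemma coord_vec_self: "c \<in> charts_at M x \<Longrightarrow> coord_vec M c x u c = u"
  by (simp add: coord_vec_chart jac_self)

lemma coord_vec_tangent: "c \<in> charts_at M x \<Longrightarrow> coord_vec M c x u \<in> tangent_space M x"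
  unfolding tangent_space_def
proof (intro CollectI conjI allI impI ballI)
  fix c' c'' assume "c \<in> charts_at M x" "c' \<in> charts_at M x" "c'' \<in> charts_at M x"
  then show "coord_vec M c x u c'' = jac c' c'' (snd c' x) (coord_vec M c x u c')"
    by (simp only: coord_vec_chart) (rule jac_cocycle)
qed (simp add: coord_vec_def)

lemma jac_tangent:
  "v \<in> tangent_space M x \<Longrightarrow> c \<in> charts_at M x \<Longrightarrow> c' \<in> charts_at M x \<Longrightarrow>
   jac c c' (snd c x) (v c) = v c'"
  unfolding tangent_space_def by (elim CollectE conjE) (rule sym, blast)

lemma tangent_outside: "v \<in> tangent_space M x \<Longrightarrow> c' \<notin> charts_at M x \<Longrightarrow> v c' = 0"
  unfolding tangent_space_def by blast

lemma tangent_eq_coord_vec: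
  "c \<in> charts_at M x \<Longrightarrow> v \<in> tangent_space M x \<Longrightarrow> coord_vec M c x (v c) = v"
  by (auto simp: coord_vec_def fun_eq_iff jac_tangent tangent_outside)

lemma coord_vec_change:
  "c \<in> charts_at M x \<Longrightarrow> c' \<in> charts_at M x \<Longrightarrow>
   coord_vec M c x u = coord_vec M c' x (jac c c' (snd c x) u)"
  unfolding coord_vec_def by (intro ext if_cong refl jac_cocycle)

lemma coord_vec_add:
  "c \<in> charts_at M x \<Longrightarrow> coord_vec M c x (u + w) = coord_vec M c x u + coord_vec M c x w"
  by (auto simp: coord_vec_def fun_eq_iff linear_add[OF linear_jac])

lemma coord_vec_scale:
  "c \<in> charts_at M x \<Longrightarrow> coord_vec M c x (r *\<^sub>R u) = tscale r (coord_vec M c x u)"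
  by (auto simp: coord_vec_def tscale_def fun_eq_iff linear_cmul[OF linear_jac])

lemma map_coord_vec:
  "c \<in> charts_at M x \<Longrightarrow> set vs \<subseteq> tangent_space M x \<Longrightarrow>
   map (coord_vec M c x) (map (\<lambda>v. v c) vs) = vs"
  by (auto simp: tangent_eq_coord_vec intro!: map_idI)

lemma map_coord_vec_self:
  "c \<in> charts_at M x \<Longrightarrow> map (\<lambda>v. v c) (map (coord_vec M c x) us) = us"
  by (auto simp: coord_vec_self intro!: map_idI)

lemma set_coord_vec: "c \<in> charts_at M x \<Longrightarrow> set (map (coord_vec M c x) us) \<subseteq> tangent_space M x"
  by (auto simp: coord_vec_tangent)


section \<open>Differential forms in charts\<close>

lemma alt_space_imp_alternating:
  assumes c: "c \<in> charts_at M x" and \<omega>: "\<omega> \<in> alt_space M k x"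
  shows "alternating k (\<lambda>us. \<omega> (map (coord_vec M c x) us))"
  unfolding alternating_def multilinear_def
proof (intro conjI allI impI; (elim conjE)?)
  fix us :: "(real ^ 'n) list" and i v w and r :: real assume "length us = k" "i < k"
  then show "\<omega> (map (coord_vec M c x) (us[i := v + w])) =
      \<omega> (map (coord_vec M c x) (us[i := v])) + \<omega> (map (coord_vec M c x) (us[i := w]))"
    and "\<omega> (map (coord_vec M c x) (us[i := r *\<^sub>R v])) = r * \<omega> (map (coord_vec M c x) (us[i := v]))"
    using \<omega> set_coord_vec[OF c, of us] coord_vec_tangent[OF c]
    by (simp_all add: alt_space_def map_update coord_vec_add[OF c] coord_vec_scale[OF c])
next
  fix us :: "(real ^ 'n) list" and i j assume "length us = k" "i < j" "j < k" "us ! i = us ! j"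
  then have "length (map (coord_vec M c x) us)
      = k \<and> set (map (coord_vec M c x) us) \<subseteq> tangent_space M x \<and>
      i < j \<and> j < k \<and> map (coord_vec M c x) us ! i = map (coord_vec M c x) us ! j"
    using set_coord_vec[OF c, of us] by simp
  then show "\<omega> (map (coord_vec M c x) us) = 0"
    using \<omega> unfolding alt_space_def mem_Collect_eq by blast
qed

lemma tangent_add:
  assumes "v \<in> tangent_space M x" "w \<in> tangent_space M x" "x \<in> points M"
  shows "v + w \<in> tangent_space M x"
proof -
  obtain c where c: "c \<in> charts_at M x" using charts_at_nonempty assms by blast
  have "v + w = coord_vec M c x (v c + w c)"
    using assms c by (simp add: coord_vec_add tangent_eq_coord_vec)
  then show ?thesis using c coord_vec_tangent by simp
qed

lemma tangent_scale:
  assumes "v \<in> tangent_space M x" "x \<in> points M"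
  shows "tscale r v \<in> tangent_space M x"
proof -
  obtain c where c: "c \<in> charts_at M x" using charts_at_nonempty assms by blast
  have "tscale r v = coord_vec M c x (r *\<^sub>R v c)"
    using assms c by (simp add: coord_vec_scale tangent_eq_coord_vec)
  then show ?thesis using c coord_vec_tangent by simp
qed

text \<open>Covectors may be given in a single chart, since a tangent vector is determined by its
  coordinates there.\<close>
lemma alternating_imp_alt_space:
  assumes c: "c \<in> charts_at M x" and m: "alternating k m"
    and \<omega>: "\<And>vs. length vs = k \<Longrightarrow> set vs \<subseteq> tangent_space M x \<Longrightarrow> \<omega> vs = m (map (\<lambda>v. v c) vs)"
    and \<omega>0: "\<And>vs. \<not> (length vs = k \<and> set vs \<subseteq> tangent_space M x) \<Longrightarrow> \<omega> vs = 0"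
  shows "\<omega> \<in> alt_space M k x"
proof -
  have x: "x \<in> points M" using c by (rule charts_at_points)
  have upd: "\<omega> (vs[i := v]) = m ((map (\<lambda>v. v c) vs)[i := v c])"
    if "length vs = k" "set vs \<subseteq> tangent_space M x" "v \<in> tangent_space M x" for vs i v
    using that set_update_subset_insert[of vs i v] by (subst \<omega>) (auto simp: map_update)
  show ?thesis
    unfolding alt_space_def
  proof (intro CollectI conjI allI impI ballI; (elim conjE)?)
    fix vs i assume vs: "length vs = k" "set vs \<subseteq> tangent_space M x" "i < k"
    have lin: "linear (\<lambda>v. m ((map (\<lambda>v. v c) vs)[i := v]))"
      using vs by (intro multilinear_slot[OF alternating_imp_multilinear[OF m]]) auto
    show "\<omega> (vs[i := v + w]) = \<omega> (vs[i := v]) + \<omega> (vs[i := w])"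
      if "v \<in> tangent_space M x" "w \<in> tangent_space M x" for v w
      using vs that tangent_add[OF that x] by (simp add: upd linear_add[OF lin])
    show "\<omega> (vs[i := tscale r v]) = r * \<omega> (vs[i := v])" if "v \<in> tangent_space M x" for v r
      using vs that tangent_scale[OF that x, of r]
      by (simp add: upd) (simp add: tscale_def linear_cmul[OF lin])
  next
    fix vs i j assume "length vs = k" "set vs \<subseteq> tangent_space M x" "i < j" "j < k" "vs ! i = vs ! j"
    then show "\<omega> vs = 0"
      by (simp add: \<omega>) (rule alternating_repeat[OF m, of _ i j], auto)
  qed (use \<omega>0 in blast)
qed

lemma local_rep_chart:
  "c \<in> charts_at M x \<Longrightarrow> local_rep M c \<alpha> us (snd c x) = \<alpha> x (map (coord_vec M c x) us)"
  by (simp add: local_rep_def chart_inv_chart)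

lemma form_eq_local_rep:
  "c \<in> charts_at M x \<Longrightarrow> set vs \<subseteq> tangent_space M x \<Longrightarrow>
   \<alpha> x vs = local_rep M c \<alpha> (map (\<lambda>v. v c) vs) (snd c x)"
  by (simp add: local_rep_chart map_coord_vec del: map_map)

text \<open>In two charts the components differ by pullback along the transition map, which is the situation
  of \<open>coord_d_pullback\<close>.\<close>
lemma local_rep_transition:
  assumes "c \<in> charts_at M x" "c' \<in> charts_at M x"
  shows "local_rep M c \<alpha> us (snd c x) = local_rep M c' \<alpha> (map (jac c c' (snd c x)) us) (snd c' x)"
proof -
  have "map (coord_vec M c x) us = map (coord_vec M c' x) (map (jac c c' (snd c x)) us)"
    using coord_vec_change[OF assms] by simp
  then show ?thesis by (simp only: local_rep_chart assms)
qed

context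
  fixes \<alpha> k
  assumes \<alpha>: "\<alpha> \<in> smooth_forms M k"
begin

lemma form_alt_space: "x \<in> points M \<Longrightarrow> \<alpha> x \<in> alt_space M k x"
  using \<alpha> by (simp add: smooth_forms_def)

lemma form_zero_outside:
  assumes "\<not> (x \<in> points M \<and> set vs \<subseteq> tangent_space M x)" shows "\<alpha> x vs = 0"
proof (cases "x \<in> points M")
  case True
  then show ?thesis using form_alt_space[OF True] assms unfolding alt_space_def by blast
next
  case False
  then have "\<alpha> x = 0" using \<alpha> unfolding smooth_forms_def by blast
  then show ?thesis by simp
qed

lemma local_rep_smooth:
  "c \<in> atlas M \<Longrightarrow> length us = k \<Longrightarrow> smooth_on (chart_img c) (local_rep M c \<alpha> us)"
  using \<alpha> by (simp add: smooth_forms_def)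

lemma local_rep_differentiable:
  "c \<in> charts_at M x \<Longrightarrow> length us = k \<Longrightarrow> local_rep M c \<alpha> us differentiable (at (snd c x))"
  by (rule smooth_on_imp_differentiable[OF local_rep_smooth chart_in_img]) (auto dest: charts_atD)

lemma local_rep_alternating:
  "c \<in> atlas M \<Longrightarrow> y \<in> chart_img c \<Longrightarrow> alternating k (\<lambda>us. local_rep M c \<alpha> us y)"
  unfolding local_rep_def
  by (intro alt_space_imp_alternating form_alt_space chart_inv_charts_at chart_inv_points)

lemma local_rep_wrong_length:
  "c \<in> atlas M \<Longrightarrow> y \<in> chart_img c \<Longrightarrow> length us \<noteq> k \<Longrightarrow> local_rep M c \<alpha> us y = 0"
  using form_alt_space[OF chart_inv_points] by (simp add: local_rep_def alt_space_def)

lemma coord_d_wrong_length: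
  assumes "c \<in> charts_at M x" "length us \<noteq> Suc k"
  shows "coord_d (local_rep M c \<alpha>) us (snd c x) = 0"
proof -
  have "frechet_derivative (local_rep M c \<alpha> (omit i us)) (at (snd c x))
      = frechet_derivative (\<lambda>_. 0) (at (snd c x))"
    if "i < length us" for i
    using assms that
    by (intro frechet_derivative_cong_open[of "chart_img c"] open_chart_img
        local_rep_wrong_length chart_in_img)
       (auto dest: charts_atD)
  then show ?thesis by (simp add: coord_d_def)
qed

lemma coord_d_chart_independent:
  assumes c: "c \<in> charts_at M x" and c': "c' \<in> charts_at M x" and "length us = Suc k"
  shows "coord_d (local_rep M c \<alpha>) us (snd c x) =
         coord_d (local_rep M c' \<alpha>) (map (jac c c' (snd c x)) us) (snd c' x)"
proof -
  have at: "c \<in> atlas M" "c' \<in> atlas M" "x \<in> fst c" "x \<in> fst c'"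
    using c c' by (auto dest: charts_atD)
  have x: "transition c c' (snd c x) = snd c' x" using at by (simp add: transition_chart)
  have "coord_d (local_rep M c \<alpha>) us (snd c x) =
      coord_d (local_rep M c' \<alpha>) (map (jac c c' (snd c x)) us) (transition c c' (snd c x))"
  proof (rule coord_d_pullback[where U = "overlap c c'" and V = "chart_img c'" and k = k])
    show "transition c c' ` overlap c c' \<subseteq> chart_img c'"
      using at by (auto simp: transition_chart chart_img_def)
    show "local_rep M c \<alpha> ws z = local_rep M c' \<alpha> (map (jac c c' z) ws) (transition c c' z)"
      if z: "z \<in> overlap c c'" for ws z
    proof -
      obtain x' where x': "z = snd c x'" "c \<in> charts_at M x'" "c' \<in> charts_at M x'"
        using z at by (auto simp: charts_at_def)
      show ?thesis
        unfolding x'(1) transition_chart[OF charts_atD[OF x'(2)]]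
        by (rule local_rep_transition[OF x'(2,3)])
    qed
    show "local_rep M c' \<alpha> us differentiable at (transition c c' (snd c x))" if "length us = k" for us
      unfolding x by (rule local_rep_differentiable[OF c' that])
  qed (use at assms open_overlap open_chart_img smooth_transition local_rep_alternating in auto)
  then show ?thesis by (simp only: x)
qed

text \<open>The definition computes in one chosen chart; by \<open>coord_d_chart_independent\<close> every other chart
  around the point gives the same value.\<close>
lemma ext_d_coord:
  assumes c: "c \<in> charts_at M x" and vs: "set vs \<subseteq> tangent_space M x"
  shows "ext_d M \<alpha> x vs = coord_d (local_rep M c \<alpha>) (map (\<lambda>v. v c) vs) (snd c x)"
proof -
  define c0 where "c0 = (SOME c. c \<in> charts_at M x)"
  have c0: "c0 \<in> charts_at M x" unfolding c0_def using c by (rule someI)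
  have x: "x \<in> points M" using c by (rule charts_at_points)
  have "ext_d M \<alpha> x vs = coord_d (local_rep M c0 \<alpha>) (map (\<lambda>v. v c0) vs) (snd c0 x)"
    using x vs by (simp add: ext_d_def coord_d_def Let_def c0_def)
  also have "\<dots> = coord_d (local_rep M c \<alpha>) (map (\<lambda>v. v c) vs) (snd c x)"
  proof (cases "length vs = Suc k")
    case True
    have "map (jac c0 c (snd c0 x)) (map (\<lambda>v. v c0) vs) = map (\<lambda>v. v c) vs"
      using vs c c0 by (auto intro: jac_tangent)
    then show ?thesis using coord_d_chart_independent[OF c0 c, of "map (\<lambda>v. v c0) vs"] True
      by (simp del: map_map)
  next
    case False
    then show ?thesis using c c0 by (simp add: coord_d_wrong_length)
  qed
  finally show ?thesis .
qed

lemma local_rep_ext_d: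
  assumes "c \<in> atlas M" "y \<in> chart_img c"
  shows "local_rep M c (ext_d M \<alpha>) us y = coord_d (local_rep M c \<alpha>) us y"
proof -
  have c: "c \<in> charts_at M (chart_inv c y)" by (rule chart_inv_charts_at[OF assms])
  have "local_rep M c (ext_d M \<alpha>) us y = ext_d M \<alpha> (chart_inv c y) (map (coord_vec M c (chart_inv c y)) us)"
    by (simp add: local_rep_def)
  also have "\<dots> = coord_d (local_rep M c \<alpha>) us (snd c (chart_inv c y))"
    by (simp only: ext_d_coord[OF c set_coord_vec[OF c]] map_coord_vec_self[OF c])
  finally show ?thesis by (simp only: chart_chart_inv[OF assms])
qed

lemma ext_d_smooth: "ext_d M \<alpha> \<in> smooth_forms M (Suc k)"
  unfolding smooth_forms_def
proof (intro CollectI conjI ballI allI impI)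
  fix x assume x: "x \<in> points M"
  obtain c where c: "c \<in> charts_at M x" using charts_at_nonempty[OF x] by blast
  show "ext_d M \<alpha> x \<in> alt_space M (Suc k) x"
  proof (rule alternating_imp_alt_space[OF c])
    show "alternating (Suc k) (\<lambda>us. coord_d (local_rep M c \<alpha>) us (snd c x))"
      using c by (intro coord_d_alternating[of "chart_img c"] open_chart_img chart_in_img
          local_rep_alternating local_rep_differentiable) (auto dest: charts_atD)
    show "ext_d M \<alpha> x vs = coord_d (local_rep M c \<alpha>) (map (\<lambda>v. v c) vs) (snd c x)"
      if "set vs \<subseteq> tangent_space M x" for vs
      by (rule ext_d_coord[OF c that])
    show "ext_d M \<alpha> x vs = 0" if "\<not> (length vs = Suc k \<and> set vs \<subseteq> tangent_space M x)" for vs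
    proof (cases "set vs \<subseteq> tangent_space M x")
      case True
      then show ?thesis using that by (simp add: ext_d_coord[OF c] coord_d_wrong_length[OF c])
    next
      case False
      then show ?thesis by (simp add: ext_d_def)
    qed
  qed
next
  fix x assume "x \<notin> points M"
  then show "ext_d M \<alpha> x = 0" by (simp add: ext_d_def fun_eq_iff)
next
  fix c and us :: "(real ^ 'n) list" assume c: "c \<in> atlas M" and us: "length us = Suc k"
  have "smooth_on (chart_img c) (coord_d (local_rep M c \<alpha>) us)"
    unfolding coord_d_def using c us
    by (intro smooth_on_sum smooth_on_mult smooth_on_const smooth_on_frechet_derivative
        local_rep_smooth open_chart_img) auto
  then show "smooth_on (chart_img c) (local_rep M c (ext_d M \<alpha>) us)"
    by (rule iffD2[OF smooth_on_cong[OF open_chart_img[OF c] local_rep_ext_d[OF c]], rotated])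
qed

end

lemma form_eqI:
  assumes "\<alpha> \<in> smooth_forms M k" "\<beta> \<in> smooth_forms M k"
    and "\<And>c x us. c \<in> charts_at M x \<Longrightarrow> local_rep M c \<alpha> us (snd c x) = local_rep M c \<beta> us (snd c x)"
  shows "\<alpha> = \<beta>"
proof (intro ext)
  fix x vs
  show "\<alpha> x vs = \<beta> x vs"
  proof (cases "x \<in> points M \<and> set vs \<subseteq> tangent_space M x")
    case True
    then obtain c where "c \<in> charts_at M x" using charts_at_nonempty by blast
    then show ?thesis using True assms(3) by (simp add: form_eq_local_rep del: map_map)
  next
    case False
    then show ?thesis using assms(1,2)[THEN form_zero_outside] by simp
  qed
qed

lemma form_add:
  assumes "\<alpha> \<in> smooth_forms M k" "\<beta> \<in> smooth_forms M k"
  shows "\<alpha> + \<beta> \<in> smooth_forms M k"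
  unfolding smooth_forms_def
proof (intro CollectI conjI ballI allI impI)
  fix x assume "x \<in> points M"
  then show "(\<alpha> + \<beta>) x \<in> alt_space M k x"
    using assms[THEN form_alt_space, of x] by (simp add: alt_space_def algebra_simps)
next
  fix c and us :: "(real ^ 'n) list" assume "c \<in> atlas M" "length us = k"
  then have "smooth_on (chart_img c) (\<lambda>y. local_rep M c \<alpha> us y + local_rep M c \<beta> us y)"
    using assms by (intro smooth_on_add open_chart_img local_rep_smooth)
  then show "smooth_on (chart_img c) (local_rep M c (\<alpha> + \<beta>) us)"
    by (simp add: local_rep_def)
qed (use assms in \<open>simp add: smooth_forms_def\<close>)

lemma form_scale:
  assumes "\<alpha> \<in> smooth_forms M k"
  shows "form_scale r \<alpha> \<in> smooth_forms M k"
  unfolding smooth_forms_def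
proof (intro CollectI conjI ballI allI impI)
  fix x assume "x \<in> points M"
  then show "form_scale r \<alpha> x \<in> alt_space M k x"
    using assms[THEN form_alt_space, of x] by (simp add: alt_space_def form_scale_def algebra_simps)
next
  fix c and us :: "(real ^ 'n) list" assume "c \<in> atlas M" "length us = k"
  then have "smooth_on (chart_img c) (\<lambda>y. r * local_rep M c \<alpha> us y)"
    using assms by (intro smooth_on_mult smooth_on_const open_chart_img local_rep_smooth)
  then show "smooth_on (chart_img c) (local_rep M c (form_scale r \<alpha>) us)"
    by (simp add: local_rep_def form_scale_def)
qed (use assms in \<open>simp add: smooth_forms_def form_scale_def fun_eq_iff\<close>)

lemma form_zero: "0 \<in> smooth_forms M k"
  by (simp add: smooth_forms_def alt_space_def local_rep_def smooth_on_const)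

sublocale forms: vector_space "form_scale :: real \<Rightarrow> ('a, 'n) form \<Rightarrow> ('a, 'n) form"
  by unfold_locales (simp_all add: form_scale_def fun_eq_iff algebra_simps)

lemma subspace_smooth_forms: "forms.subspace (smooth_forms M k)"
  by (simp add: forms.subspace_def form_zero form_add form_scale)

lemma ext_d_add:
  assumes "\<alpha> \<in> smooth_forms M k" "\<beta> \<in> smooth_forms M k"
  shows "ext_d M (\<alpha> + \<beta>) = ext_d M \<alpha> + ext_d M \<beta>"
proof (rule form_eqI[OF ext_d_smooth form_add[OF ext_d_smooth ext_d_smooth]])
  fix c x and us :: "(real ^ 'n) list" assume c: "c \<in> charts_at M x"
  note c' = charts_atD(1)[OF c] chart_in_img[OF c]
  show "local_rep M c (ext_d M (\<alpha> + \<beta>)) us (snd c x)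
      = local_rep M c (ext_d M \<alpha> + ext_d M \<beta>) us (snd c x)"
  proof (cases "length us = Suc k")
    case True
    have "frechet_derivative (local_rep M c (\<alpha> + \<beta>) (omit i us)) (at (snd c x)) u =
      frechet_derivative (local_rep M c \<alpha> (omit i us)) (at (snd c x)) u +
      frechet_derivative (local_rep M c \<beta> (omit i us)) (at (snd c x)) u" if "i < Suc k" for i u
    proof -
      have "((\<lambda>y. local_rep M c \<alpha> (omit i us) y + local_rep M c \<beta> (omit i us) y) has_derivative
        (\<lambda>u. frechet_derivative (local_rep M c \<alpha> (omit i us)) (at (snd c x)) u +
          frechet_derivative (local_rep M c \<beta> (omit i us)) (at (snd c x)) u)) (at (snd c x))"
        using True that assms c
        by (intro has_derivative_add iffD1[OF frechet_derivative_works] local_rep_differentiable) auto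
      moreover have "local_rep M c (\<alpha> + \<beta>) (omit i us) =
          (\<lambda>y. local_rep M c \<alpha> (omit i us) y + local_rep M c \<beta> (omit i us) y)"
        by (simp add: local_rep_def)
      ultimately show ?thesis by (simp add: frechet_derivative_at[symmetric])
    qed
    then have "coord_d (local_rep M c (\<alpha> + \<beta>)) us (snd c x) =
        coord_d (local_rep M c \<alpha>) us (snd c x) + coord_d (local_rep M c \<beta>) us (snd c x)"
      by (simp add: coord_d_def True algebra_simps sum.distrib del: sum.lessThan_Suc)
    moreover have "local_rep M c (ext_d M \<alpha> + ext_d M \<beta>) us (snd c x) =
        local_rep M c (ext_d M \<alpha>) us (snd c x) + local_rep M c (ext_d M \<beta>) us (snd c x)"
      by (simp add: local_rep_def)
    ultimately show ?thesis
      by (simp add: local_rep_ext_d[OF assms(1) c'] local_rep_ext_d[OF assms(2) c']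
          local_rep_ext_d[OF form_add[OF assms] c'])
  next
    case False
    then show ?thesis
      by (simp add: local_rep_wrong_length[OF ext_d_smooth[OF form_add[OF assms]] c']
          local_rep_wrong_length[OF form_add[OF ext_d_smooth ext_d_smooth] c', OF assms])
  qed
qed (use assms in \<open>auto intro: form_add\<close>)

lemma ext_d_scale:
  assumes "\<alpha> \<in> smooth_forms M k"
  shows "ext_d M (form_scale r \<alpha>) = form_scale r (ext_d M \<alpha>)"
proof (rule form_eqI[OF ext_d_smooth form_scale[OF ext_d_smooth]])
  fix c x and us :: "(real ^ 'n) list" assume c: "c \<in> charts_at M x"
  note c' = charts_atD(1)[OF c] chart_in_img[OF c]
  show "local_rep M c (ext_d M (form_scale r \<alpha>)) us (snd c x)
      = local_rep M c (form_scale r (ext_d M \<alpha>)) us (snd c x)"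
  proof (cases "length us = Suc k")
    case True
    have "frechet_derivative (local_rep M c (form_scale r \<alpha>) (omit i us)) (at (snd c x)) u =
      r * frechet_derivative (local_rep M c \<alpha> (omit i us)) (at (snd c x)) u" if "i < Suc k" for i u
    proof -
      have "((\<lambda>y. r * local_rep M c \<alpha> (omit i us) y) has_derivative
        (\<lambda>u. r * frechet_derivative (local_rep M c \<alpha> (omit i us)) (at (snd c x)) u)) (at (snd c x))"
        using True that assms c
        by (intro has_derivative_mult_right iffD1[OF frechet_derivative_works]
            local_rep_differentiable) auto
      moreover have "local_rep M c (form_scale r \<alpha>) (omit i us)
          = (\<lambda>y. r * local_rep M c \<alpha> (omit i us) y)"
        by (simp add: local_rep_def form_scale_def)
      ultimately show ?thesis by (simp add: frechet_derivative_at[symmetric])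
    qed
    then have "coord_d (local_rep M c (form_scale r \<alpha>)) us (snd c x) =
        r * coord_d (local_rep M c \<alpha>) us (snd c x)"
      by (simp add: coord_d_def True sum_distrib_left mult.left_commute del: sum.lessThan_Suc)
    moreover have "local_rep M c (form_scale r (ext_d M \<alpha>)) us (snd c x) =
        r * local_rep M c (ext_d M \<alpha>) us (snd c x)"
      by (simp add: local_rep_def form_scale_def)
    ultimately show ?thesis
      by (simp add: local_rep_ext_d[OF assms c'] local_rep_ext_d[OF form_scale[OF assms] c'])
  next
    case False
    then show ?thesis
      by (simp add: local_rep_wrong_length[OF ext_d_smooth[OF form_scale[OF assms]] c']
          local_rep_wrong_length[OF form_scale[OF ext_d_smooth[OF assms]] c'])
  qed
qed (use assms in \<open>auto intro: form_scale\<close>)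

end


section \<open>The comass on a compact manifold\<close>

locale riemannian_manifold =
  fixes M :: "('a, 'n::finite) riem_space"
  assumes riem: "oriented_riemannian_manifold M"

sublocale riemannian_manifold \<subseteq> manifold
  using riem by unfold_locales (simp add: oriented_riemannian_manifold_def)

context riemannian_manifold
begin

definition coord_metric ::
  "('a, 'n) chart \<Rightarrow> real ^ 'n \<Rightarrow> real ^ 'n \<Rightarrow> real ^ 'n \<Rightarrow> real" where
  "coord_metric c y u w = metric M (chart_inv c y)
     (coord_vec M c (chart_inv c y) u) (coord_vec M c (chart_inv c y) w)"

text \<open>The frames whose wedge products are the unit simple \<open>p\<close>-vectors; a form is evaluated on such a
  \<open>p\<close>-vector by evaluating it on a frame.\<close>
definition unit_frames :: "nat \<Rightarrow> 'a \<Rightarrow> ('a, 'n) tvec list set" where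
  "unit_frames p x =
     {vs. length vs = p \<and> set vs \<subseteq> tangent_space M x \<and> gram_det M x vs = 1}"

definition comass_bounded :: "nat \<Rightarrow> ('a, 'n) form \<Rightarrow> real \<Rightarrow> bool" where
  "comass_bounded p \<beta> s \<longleftrightarrow> (\<forall>x\<in>points M. \<forall>vs\<in>unit_frames p x. \<bar>\<beta> x vs\<bar> \<le> s)"

lemma
  assumes "c \<in> atlas M" "y \<in> chart_img c"
  shows coord_metric_commute: "coord_metric c y u w = coord_metric c y w u"
    and linear_coord_metric: "linear (coord_metric c y u)"
    and coord_metric_pos: "u \<noteq> 0 \<Longrightarrow> coord_metric c y u u > 0"
proof -
  let ?x = "chart_inv c y"
  have c: "c \<in> charts_at M ?x" by (rule chart_inv_charts_at[OF assms])
  note tan = coord_vec_tangent[OF c]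
  have ip: "inner_product_on (tangent_space M ?x) (metric M ?x)"
    using riem chart_inv_points[OF assms] by (simp add: oriented_riemannian_manifold_def)
  note ip = ip[unfolded inner_product_on_def]
  show sym: "coord_metric c y u w = coord_metric c y w u" for u w
    unfolding coord_metric_def by (rule ip[THEN conjunct1, THEN bspec, THEN bspec, OF tan tan])
  have "linear (\<lambda>w. coord_metric c y w u)"
    using ip[THEN conjunct2] tan unfolding coord_metric_def
    by (intro linearI) (simp_all add: coord_vec_add[OF c] coord_vec_scale[OF c])
  moreover have "(\<lambda>w. coord_metric c y w u) = coord_metric c y u" by (intro ext sym)
  ultimately show "linear (coord_metric c y u)" by simp
  have "coord_vec M c ?x u \<noteq> 0" if "u \<noteq> 0"
    using coord_vec_self[OF c, of u] that by auto
  then show "coord_metric c y u u > 0" if "u \<noteq> 0"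
    using ip[THEN conjunct2] tan that by (simp add: coord_metric_def)
qed

lemma continuous_on_coord_metric:
  "c \<in> atlas M \<Longrightarrow> continuous_on (chart_img c) (\<lambda>y. coord_metric c y u w)"
  using riem smooth_on_imp_continuous_on
  unfolding oriented_riemannian_manifold_def coord_metric_def by blast

lemma coord_metric_expand:
  assumes "c \<in> atlas M" "y \<in> chart_img c"
  shows "coord_metric c y u u = (\<Sum>a\<in>Basis. \<Sum>b\<in>Basis. (u \<bullet> a) * (u \<bullet> b) * coord_metric c y a b)"
proof -
  have expand: "coord_metric c y v u = (\<Sum>b\<in>Basis. (u \<bullet> b) * coord_metric c y v b)" for v
  proof -
    have "coord_metric c y v u = coord_metric c y v (\<Sum>b\<in>Basis. (u \<bullet> b) *\<^sub>R b)"
      by (simp add: euclidean_representation)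
    then show ?thesis
      by (simp add: linear_sum[OF linear_coord_metric[OF assms]]
          linear_cmul[OF linear_coord_metric[OF assms]])
  qed
  have "coord_metric c y u u = (\<Sum>a\<in>Basis. (u \<bullet> a) * coord_metric c y u a)" by (rule expand)
  also have "\<dots> = (\<Sum>a\<in>Basis. (u \<bullet> a) * (\<Sum>b\<in>Basis. (u \<bullet> b) * coord_metric c y a b))"
    by (intro sum.cong refl) (simp only: coord_metric_commute[OF assms, of u] expand)
  finally show ?thesis by (simp add: sum_distrib_left mult.assoc)
qed

text \<open>By homogeneity the minimum of the metric over \<open>K\<close> times the unit sphere is such a constant for
  nonempty \<open>K\<close>; it is attained, hence positive.\<close>
lemma coord_metric_lower_bound:
  assumes c: "c \<in> atlas M" and K: "compact K" "K \<subseteq> chart_img c"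
  obtains e where "e > 0" "\<And>y u. y \<in> K \<Longrightarrow> coord_metric c y u u \<ge> e * (norm u)\<^sup>2"
proof (cases "K = {}")
  case True
  then show ?thesis using that[of 1] by simp
next
  case False
  let ?S = "K \<times> sphere (0 :: real ^ 'n) 1"
  let ?f = "\<lambda>z. coord_metric c (fst z) (snd z) (snd z)"
  have "continuous_on ?S (\<lambda>z. \<Sum>a\<in>Basis. \<Sum>b\<in>Basis.
      (snd z \<bullet> a) * (snd z \<bullet> b) * coord_metric c (fst z) a b)"
    using K(2) by (intro continuous_intros
        continuous_on_compose2[OF continuous_on_coord_metric[OF c]]) auto
  then have "continuous_on ?S ?f"
    using K(2) by (subst continuous_on_cong[OF refl coord_metric_expand[OF c]]) auto
  moreover have "compact ?S" using K by (intro compact_Times) auto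
  moreover have "?S \<noteq> {}"
  proof -
    obtain b :: "real ^ 'n" where "b \<in> Basis" using nonempty_Basis by blast
    then have "b \<in> sphere 0 1" by simp
    then show ?thesis using False by auto
  qed
  ultimately obtain z where z: "z \<in> ?S" "\<And>z'. z' \<in> ?S \<Longrightarrow> ?f z \<le> ?f z'"
    using continuous_attains_inf[of ?S ?f] by blast
  show thesis
  proof (rule that[of "?f z"])
    have "snd z \<noteq> 0" using z(1) by auto
    then show "?f z > 0" using z(1) K(2) by (intro coord_metric_pos[OF c]) auto
    fix y u assume y: "y \<in> K"
    have lin: "linear (coord_metric c y v)" for v using y K(2)
        by (intro linear_coord_metric[OF c]) auto
    show "coord_metric c y u u \<ge> ?f z * (norm u)\<^sup>2"
    proof (cases "u = 0")
      case True
      then show ?thesis using linear_0[OF lin] by simp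
    next
      case False
      let ?v = "u /\<^sub>R norm u"
      have "?f z \<le> coord_metric c y ?v ?v" using z(2)[of "(y, ?v)"] y False by simp
      moreover have "coord_metric c y u u = (norm u)\<^sup>2 * coord_metric c y ?v ?v"
      proof -
        have "u = norm u *\<^sub>R ?v" using False by simp
        then have "coord_metric c y u u = coord_metric c y (norm u *\<^sub>R ?v) (norm u *\<^sub>R ?v)" by simp
        also have "\<dots> = norm u * coord_metric c y (norm u *\<^sub>R ?v) ?v"
          by (rule linear_cmul[OF lin, of "norm u *\<^sub>R ?v" "norm u" ?v, simplified real_scaleR_def])
        also have "coord_metric c y (norm u *\<^sub>R ?v) ?v = coord_metric c y ?v (norm u *\<^sub>R ?v)"
          using y K(2) by (intro coord_metric_commute[OF c]) auto
        also have "\<dots> = norm u * coord_metric c y ?v ?v"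
          by (rule linear_cmul[OF lin, of ?v "norm u" ?v, simplified real_scaleR_def])
        finally show ?thesis by (simp add: power2_eq_square)
      qed
      ultimately show ?thesis by (simp add: mult.commute mult_left_mono)
    qed
  qed
qed

lemma gram_det_coord:
  assumes "c \<in> atlas M" "y \<in> chart_img c" "set vs \<subseteq> tangent_space M (chart_inv c y)"
  shows "gram_det M (chart_inv c y) vs =
    cross_gram (coord_metric c y) (map (\<lambda>v. v c) vs) (map (\<lambda>v. v c) vs)"
proof -
  let ?x = "chart_inv c y"
  have c: "c \<in> charts_at M ?x" by (rule chart_inv_charts_at[OF assms(1,2)])
  have "metric M ?x (vs ! i) (vs ! j) =
      coord_metric c y (map (\<lambda>v. v c) vs ! i) (map (\<lambda>v. v c) vs ! j)"
    if "i < length vs" "j < length vs" for i j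
    using that assms(3) by (simp add: coord_metric_def tangent_eq_coord_vec[OF c] subset_iff)
  then show ?thesis
    unfolding gram_det_def cross_gram_def length_map
    by (intro sum.cong prod.cong refl arg_cong2[of _ _ _ _ "(*)"])
       (auto simp: permutes_in_image[of _ "{..<length vs}", simplified lessThan_iff] simp del: nth_map)
qed

text \<open>A unit frame may consist of very long vectors, so \<open>\<beta>\<close> cannot be estimated vector by vector.
  The bound for alternating functions in terms of the Gram determinant, together with the uniform
  lower bound of the metric on \<open>K\<close>, gives a constant that depends on \<open>K\<close> only.\<close>
lemma local_comass_bound:
  assumes c: "c \<in> atlas M" and K: "compact K" "K \<subseteq> chart_img c"
  obtains C where "C > 0" "\<And>\<beta> y r vs. \<beta> \<in> smooth_forms M p \<Longrightarrow> y \<in> K \<Longrightarrow> r \<ge> 0 \<Longrightarrow>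
    (\<And>bs. bs \<in> basis_lists p \<Longrightarrow> \<bar>local_rep M c \<beta> bs y\<bar> \<le> r) \<Longrightarrow>
    vs \<in> unit_frames p (chart_inv c y) \<Longrightarrow> \<bar>\<beta> (chart_inv c y) vs\<bar> \<le> C * r"
proof -
  obtain e where e: "e > 0" "\<And>y u. y \<in> K \<Longrightarrow> coord_metric c y u u \<ge> e * (norm u)\<^sup>2"
    using coord_metric_lower_bound[OF c K] by blast
  define C where "C = real (card (basis_lists p :: (real ^ 'n) list set)) * sqrt (1 / e ^ p)"
  have "\<bar>\<beta> (chart_inv c y) vs\<bar> \<le> (C + 1) * r"
    if \<beta>: "\<beta> \<in> smooth_forms M p" and y: "y \<in> K" and r: "r \<ge> 0"
      "\<And>bs. bs \<in> basis_lists p \<Longrightarrow> \<bar>local_rep M c \<beta> bs y\<bar> \<le> r"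
      and vs: "vs \<in> unit_frames p (chart_inv c y)" for \<beta> y r vs
  proof -
    have yc: "y \<in> chart_img c" using y K by auto
    have at: "c \<in> charts_at M (chart_inv c y)" by (rule chart_inv_charts_at[OF c yc])
    let ?us = "map (\<lambda>v. v c) vs"
    have vs': "length vs = p" "set vs \<subseteq> tangent_space M (chart_inv c y)"
        "gram_det M (chart_inv c y) vs = 1"
      using vs by (simp_all add: unit_frames_def)
    have "\<bar>local_rep M c \<beta> ?us y\<bar> \<le> C * r"
      unfolding C_def
    proof (rule alternating_bound_gram[where g = "coord_metric c y" and m
        = "\<lambda>us. local_rep M c \<beta> us y"])
      show "cross_gram (coord_metric c y) ?us ?us = 1"
        using gram_det_coord[OF c yc vs'(2)] vs'(3) by simp
      show "coord_metric c y u w = coord_metric c y w u" for u w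
          by (rule coord_metric_commute[OF c yc])
    qed (use e y r vs' linear_coord_metric[OF c yc] local_rep_alternating[OF \<beta> c yc] in auto)
    moreover have "\<beta> (chart_inv c y) vs = local_rep M c \<beta> ?us y"
      using form_eq_local_rep[OF at vs'(2)] by (simp add: chart_chart_inv[OF c yc])
    ultimately show ?thesis using r(1) by (simp add: distrib_right)
  qed
  moreover have "C + 1 > 0" using e(1) by (simp add: C_def add_nonneg_pos)
  ultimately show thesis using that by blast
qed

lemma finite_chart_cover:
  assumes "compact_space (underlying M)"
  obtains \<K> where "finite \<K>"
    "\<And>c K. (c, K) \<in> \<K> \<Longrightarrow> c \<in> atlas M \<and> compact K \<and> K \<subseteq> chart_img c"
    "\<And>x. x \<in> points M \<Longrightarrow> \<exists>(c, K)\<in>\<K>. \<exists>y\<in>K. x = chart_inv c y"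
proof -
  have "\<exists>c e. c \<in> charts_at M x \<and> e > 0 \<and> cball (snd c x) e \<subseteq> chart_img c" if "x \<in> points M" for x
  proof -
    obtain c where c: "c \<in> charts_at M x" using charts_at_nonempty \<open>x \<in> points M\<close> by blast
    then show ?thesis
      using open_contains_cball[of "chart_img c"] open_chart_img[OF charts_atD(1)] chart_in_img by blast
  qed
  then obtain c e where ce: "\<And>x. x \<in> points M \<Longrightarrow> c x \<in> charts_at M x"
    "\<And>x. x \<in> points M \<Longrightarrow> e x > 0" "\<And>x. x \<in> points M \<Longrightarrow> cball (snd (c x) x) (e x) \<subseteq> chart_img (c x)"
    by metis
  define W where "W = (\<lambda>x. {x' \<in> fst (c x). snd (c x) x' \<in> ball (snd (c x) x) (e x)})"
  have "openin (underlying M) (W x)" if x: "x \<in> points M" for x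
  proof -
    note at = charts_atD(1)[OF ce(1)[OF x]]
    have "continuous_map (subtopology (underlying M) (fst (c x))) (top_of_set (chart_img (c x)))
        (snd (c x))"
      using homeomorphic_imp_continuous_map[OF homeomorphic_chart[OF at]] .
    then have "continuous_map (subtopology (underlying M) (fst (c x))) euclidean (snd (c x))"
      by (simp add: continuous_map_in_subtopology)
    then have "openin (subtopology (underlying M) (fst (c x)))
        {x' \<in> topspace (subtopology (underlying M) (fst (c x))).
            snd (c x) x' \<in> ball (snd (c x) x) (e x)}"
      by (rule openin_continuous_map_preimage) simp
    moreover have "{x' \<in> topspace (subtopology (underlying M) (fst (c x))).
        snd (c x) x' \<in> ball (snd (c x) x) (e x)} = W x"
      using chart_subset[OF at] by (auto simp: W_def)
    ultimately show ?thesis using openin_trans_full openin_chart[OF at] by metis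
  qed
  moreover have "x \<in> W x" if "x \<in> points M" for x
    using ce[OF that] charts_atD(2) by (auto simp: W_def)
  ultimately obtain \<F> where \<F>: "finite \<F>" "\<F> \<subseteq> W ` points M" "points M \<subseteq> \<Union>\<F>"
    using assms[unfolded compact_space_alt, rule_format, of "W ` points M"] by blast
  then obtain X where X: "finite X" "X \<subseteq> points M" "\<F> = W ` X"
    by (meson finite_subset_image)
  show thesis
  proof (rule that[of "(\<lambda>x. (c x, cball (snd (c x) x) (e x))) ` X"])
    show "finite ((\<lambda>x. (c x, cball (snd (c x) x) (e x))) ` X)" using X by simp
    show "c' \<in> atlas M \<and> compact K \<and> K \<subseteq> chart_img c'"
      if cK: "(c', K) \<in> (\<lambda>x. (c x, cball (snd (c x) x) (e x))) ` X" for c' K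
    proof -
      obtain x where x: "x \<in> points M" "c' = c x" "K = cball (snd (c x) x) (e x)"
        using cK X(2) by blast
      then show ?thesis using ce(3)[OF x(1)] charts_atD(1)[OF ce(1)[OF x(1)]] by simp
    qed
    fix x assume "x \<in> points M"
    then obtain z where z: "z \<in> X" "x \<in> W z" using X \<F> by auto
    then have "z \<in> points M" using X(2) by blast
    then have "c z \<in> charts_at M x" "snd (c z) x \<in> cball (snd (c z) z) (e z)"
      using charts_atD(1)[OF ce(1)] z(2) by (simp_all add: W_def charts_at_def)
    then show "\<exists>(c, K)\<in>(\<lambda>x. (c x, cball (snd (c x) x) (e x))) ` X. \<exists>y\<in>K. x = chart_inv c y"
      using z(1) chart_inv_chart[of "c z" x]
      by (intro bexI[of _ "(c z, cball (snd (c z) z) (e z))"] case_prodI bexI[of _ "snd (c z) x"])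
        simp_all
  qed
qed

definition coeffs_bounded ::
  "(('a, 'n) chart \<times> (real ^ 'n) set) set \<Rightarrow> nat \<Rightarrow> ('a, 'n) form \<Rightarrow> real \<Rightarrow> bool" where
  "coeffs_bounded \<K> p \<beta> r \<longleftrightarrow>
     (\<forall>c K y bs. (c, K) \<in> \<K> \<and> y \<in> K \<and> bs \<in> basis_lists p \<longrightarrow> \<bar>local_rep M c \<beta> bs y\<bar> \<le> r)"

text \<open>Finitely many compact pieces of charts cover the manifold, so the local constants are bounded, and
  the comass is controlled by finitely many of the seminorms that define the topology on forms.\<close>
lemma comass_bound:
  assumes "compact_space (underlying M)"
  obtains \<K> C where "finite \<K>"
    "\<And>c K. (c, K) \<in> \<K> \<Longrightarrow> c \<in> atlas M \<and> compact K \<and> K \<subseteq> chart_img c"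
    "C > 0" "\<And>\<beta> r. \<beta> \<in> smooth_forms M p \<Longrightarrow> r \<ge> 0 \<Longrightarrow>
      coeffs_bounded \<K> p \<beta> r \<Longrightarrow> comass_bounded p \<beta> (C * r)"
proof -
  obtain \<K> where \<K>: "finite \<K>"
    "\<And>c K. (c, K) \<in> \<K> \<Longrightarrow> c \<in> atlas M \<and> compact K \<and> K \<subseteq> chart_img c"
    "\<And>x. x \<in> points M \<Longrightarrow> \<exists>(c, K)\<in>\<K>. \<exists>y\<in>K. x = chart_inv c y"
    by (rule finite_chart_cover[OF assms]) (rule that; assumption)
  define bounds where "bounds = (\<lambda>k C. C > 0 \<and> (\<forall>\<beta> y r vs. \<beta> \<in> smooth_forms M p \<longrightarrow> y \<in> snd k \<longrightarrow>
    r \<ge> 0 \<longrightarrow> (\<forall>bs\<in>basis_lists p. \<bar>local_rep M (fst k) \<beta> bs y\<bar> \<le> r) \<longrightarrow>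
    vs \<in> unit_frames p (chart_inv (fst k) y) \<longrightarrow> \<bar>\<beta> (chart_inv (fst k) y) vs\<bar> \<le> C * r))"
  have "\<exists>C. bounds k C" if "k \<in> \<K>" for k
  proof -
    have "fst k \<in> atlas M" "compact (snd k)" "snd k \<subseteq> chart_img (fst k)"
      using \<K>(2)[of "fst k" "snd k"] that by auto
    from local_comass_bound[OF this, of p] show ?thesis
      unfolding bounds_def by (metis (no_types, lifting))
  qed
  then obtain C where C: "\<And>k. k \<in> \<K> \<Longrightarrow> bounds k (C k)" by metis
  then have C_pos: "\<And>k. k \<in> \<K> \<Longrightarrow> C k > 0" by (simp add: bounds_def)
  show thesis
  proof (rule that[of \<K> "1 + sum C \<K>"])
    show "0 < 1 + sum C \<K>" using C_pos by (simp add: add_pos_nonneg less_imp_le sum_nonneg)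
    show "comass_bounded p \<beta> ((1 + sum C \<K>) * r)"
      if \<beta>: "\<beta> \<in> smooth_forms M p" and "r \<ge> 0" and
        *: "coeffs_bounded \<K> p \<beta> r" for \<beta> r
      unfolding comass_bounded_def
    proof (intro ballI)
      fix x vs assume "x \<in> points M" and vs: "vs \<in> unit_frames p x"
      then obtain k y where k: "k \<in> \<K>" "y \<in> snd k" "x = chart_inv (fst k) y"
        using \<K>(3) by fastforce
      have "\<forall>bs\<in>basis_lists p. \<bar>local_rep M (fst k) \<beta> bs y\<bar> \<le> r"
        using *[unfolded coeffs_bounded_def, rule_format, of "fst k" "snd k" y] k(1,2) by simp
      then have "\<bar>\<beta> x vs\<bar> \<le> C k * r"
        using C[OF k(1)] k(2,3) vs \<open>r \<ge> 0\<close> \<beta> unfolding bounds_def by blast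
      also have "\<dots> \<le> (1 + sum C \<K>) * r"
        using member_le_sum[OF k(1), of C] C_pos \<K>(1) \<open>r \<ge> 0\<close>
        by (intro mult_right_mono) (auto simp: less_imp_le)
      finally show "\<bar>\<beta> x vs\<bar> \<le> (1 + sum C \<K>) * r" .
    qed
  qed (use \<K> in auto)
qed

lemma smooth_form_comass_bounded:
  assumes "compact_space (underlying M)" "\<beta> \<in> smooth_forms M p"
  obtains s where "s > 0" "comass_bounded p \<beta> s"
proof -
  obtain \<K> C where \<K>: "finite \<K>"
    "\<And>c K. (c, K) \<in> \<K> \<Longrightarrow> c \<in> atlas M \<and> compact K \<and> K \<subseteq> chart_img c" and C: "C > 0"
    and bound: "\<And>\<beta> r. \<beta> \<in> smooth_forms M p \<Longrightarrow> r \<ge> 0 \<Longrightarrow>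
      coeffs_bounded \<K> p \<beta> r \<Longrightarrow> comass_bounded p \<beta> (C * r)"
    by (rule comass_bound[OF assms(1), where p = p]) (rule that; assumption)
  define bounds where "bounds = (\<lambda>k r. r \<ge> 0 \<and>
    (\<forall>y\<in>snd k. \<forall>bs\<in>basis_lists p. \<bar>local_rep M (fst k) \<beta> bs y\<bar> \<le> r))"
  have "\<exists>r. bounds k r" if "k \<in> \<K>" for k
  proof -
    let ?h = "\<lambda>y. \<Sum>bs\<in>basis_lists p. \<bar>local_rep M (fst k) \<beta> bs y\<bar>"
    have k: "fst k \<in> atlas M" "compact (snd k)" "snd k \<subseteq> chart_img (fst k)"
      using \<K>(2)[of "fst k" "snd k"] that by auto
    have "continuous_on (snd k) ?h"
      using k assms(2) by (intro continuous_intros continuous_on_subset[OF _ k(3)]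
          smooth_on_imp_continuous_on local_rep_smooth[OF assms(2)]) auto
    then have "bounded (?h ` snd k)"
      using k(2) by (intro compact_imp_bounded compact_continuous_image)
    then obtain r where r: "\<And>y. y \<in> snd k \<Longrightarrow> \<bar>?h y\<bar> \<le> r" by (auto simp: bounded_iff)
    have "\<bar>local_rep M (fst k) \<beta> bs y\<bar> \<le> max r 0" if "y \<in> snd k" "bs \<in> basis_lists p" for y bs
    proof -
      have "\<bar>local_rep M (fst k) \<beta> bs y\<bar> \<le> ?h y"
        using that(2) finite_basis_lists by (intro member_le_sum) auto
      then show ?thesis using r[OF that(1)] by linarith
    qed
    then show ?thesis unfolding bounds_def by (intro exI[of _ "max r 0"]) auto
  qed
  then obtain r where r: "\<And>k. k \<in> \<K> \<Longrightarrow> bounds k (r k)" by metis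
  have r_nonneg: "r k \<ge> 0" if "k \<in> \<K>" for k using r[OF that] by (simp add: bounds_def)
  have "coeffs_bounded \<K> p \<beta> (1 + sum r \<K>)"
    unfolding coeffs_bounded_def
  proof (intro allI impI; elim conjE)
    fix c K y bs assume "(c, K) \<in> \<K>" "y \<in> K" "bs \<in> (basis_lists p :: (real ^ 'n) list set)"
    then have "\<bar>local_rep M c \<beta> bs y\<bar> \<le> r (c, K)" using r[of "(c, K)"] by (simp add: bounds_def)
    also have "\<dots> \<le> 1 + sum r \<K>"
      using member_le_sum[OF \<open>(c, K) \<in> \<K>\<close>, of r] r_nonneg \<K>(1) by simp
    finally show "\<bar>local_rep M c \<beta> bs y\<bar> \<le> 1 + sum r \<K>" .
  qed
  moreover have "1 + sum r \<K> \<ge> 0" using r_nonneg by (simp add: add_increasing sum_nonneg)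
  ultimately have "comass_bounded p \<beta> (C * (1 + sum r \<K>))" by (intro bound assms(2))
  moreover have "C * (1 + sum r \<K>) > 0"
    using C r_nonneg by (intro mult_pos_pos add_pos_nonneg sum_nonneg) auto
  ultimately show thesis using that by blast
qed

text \<open>A linear functional that is bounded on the forms of comass at most one is a current: the comass
  is dominated by finitely many of the seminorms, and those only involve derivatives of order \<open>0\<close>.\<close>
lemma bounded_functional_continuous:
  assumes comp: "compact_space (underlying M)"
    and add: "\<And>\<alpha> \<beta>. \<alpha> \<in> smooth_forms M p \<Longrightarrow> \<beta> \<in> smooth_forms M p \<Longrightarrow> T (\<alpha> + \<beta>) = T \<alpha> + T \<beta>"
    and scale: "\<And>\<alpha> r. \<alpha> \<in> smooth_forms M p \<Longrightarrow> T (form_scale r \<alpha>) = r * T \<alpha>"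
    and B: "\<And>\<beta>. \<beta> \<in> smooth_forms M p \<Longrightarrow> comass_bounded p \<beta> 1 \<Longrightarrow> \<bar>T \<beta>\<bar> \<le> B" "B \<ge> 0"
  shows "continuous_map (form_topology M p) euclideanreal T"
proof -
  obtain \<K> C where \<K>: "finite \<K>"
    "\<And>c K. (c, K) \<in> \<K> \<Longrightarrow> c \<in> atlas M \<and> compact K \<and> K \<subseteq> chart_img c" and C: "C > 0"
    and bound: "\<And>\<beta> r. \<beta> \<in> smooth_forms M p \<Longrightarrow> r \<ge> 0 \<Longrightarrow>
      coeffs_bounded \<K> p \<beta> r \<Longrightarrow> comass_bounded p \<beta> (C * r)"
    by (rule comass_bound[OF comp, where p = p]) (rule that; assumption)
  have T_bound: "\<bar>T \<beta>\<bar> \<le> C * r * B" if \<beta>: "\<beta> \<in> smooth_forms M p" and "r > 0" and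
      *: "coeffs_bounded \<K> p \<beta> r" for \<beta> r
  proof -
    have "comass_bounded p \<beta> (C * r)" using \<open>r > 0\<close> * by (intro bound \<beta>) auto
    then have "comass_bounded p (form_scale (1 / (C * r)) \<beta>) 1"
      using C \<open>r > 0\<close> by (simp add: comass_bounded_def form_scale_def abs_mult field_simps)
    then have "\<bar>T (form_scale (1 / (C * r)) \<beta>)\<bar> \<le> B" by (intro B form_scale \<beta>)
    then show ?thesis using C \<open>r > 0\<close> by (simp add: scale[OF \<beta>] abs_mult field_simps)
  qed
  let ?X = "form_topology M p"
  let ?N = "\<lambda>\<alpha> c K bs r. {\<beta> \<in> smooth_forms M p. \<forall>y\<in>K. \<bar>iter_deriv [] (local_rep M c (\<beta> - \<alpha>) bs) y\<bar> < r}"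
  have top: "topspace ?X = smooth_forms M p"
    unfolding form_topology_def topology_generated_by_topspace by blast
  have op_all: "openin ?X (smooth_forms M p)" using openin_topspace[of ?X] by (simp add: top)
  have op: "openin ?X (?N \<alpha> c K bs r)"
    if "\<alpha> \<in> smooth_forms M p" "(c, K) \<in> \<K>" "bs \<in> basis_lists p" "r > 0" for \<alpha> c K bs r
    unfolding form_topology_def
  proof (rule topology_generated_by_Basis, rule insertI2, rule CollectI)
    show "\<exists>\<alpha>' c' K' bs' us' r'. ?N \<alpha> c K bs r =
        {\<beta> \<in> smooth_forms M p. \<forall>y\<in>K'. \<bar>iter_deriv bs' (local_rep M c' (\<beta> - \<alpha>') us') y\<bar> < r'} \<and>
        \<alpha>' \<in> smooth_forms M p \<and> c' \<in> atlas M \<and> compact K' \<and> K' \<subseteq> chart_img c' \<and>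
        set bs' \<subseteq> Basis \<and> set us' \<subseteq> Basis \<and> length us' = p \<and> 0 < r'"
      using that \<K>(2)[OF that(2)]
      by (intro exI[of _ \<alpha>] exI[of _ c] exI[of _ K] exI[of _ "[]"] exI[of _ bs] exI[of _ r]) simp
  qed
  show ?thesis
    unfolding continuous_map_def
  proof (intro conjI allI impI)
    fix W :: "real set" assume "openin euclideanreal W"
    then have W: "open W" by simp
    show "openin ?X {\<alpha> \<in> topspace ?X. T \<alpha> \<in> W}"
    proof (subst openin_subopen, intro ballI)
      fix \<alpha> assume "\<alpha> \<in> {\<alpha> \<in> topspace ?X. T \<alpha> \<in> W}"
      then have \<alpha>: "\<alpha> \<in> smooth_forms M p" "T \<alpha> \<in> W" by (auto simp: top)
      obtain \<epsilon> where \<epsilon>: "\<epsilon> > 0" "ball (T \<alpha>) \<epsilon> \<subseteq> W" using W \<alpha>(2) openE by blast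
      \<comment> \<open>adding \<open>1\<close> covers the case \<open>B = 0\<close>\<close>
      define r where "r = \<epsilon> / (C * B + 1)"
      have CB: "C * B + 1 > 0" using C B(2) by (simp add: add_nonneg_pos)
      have r: "r > 0" "C * r * B < \<epsilon>"
        using \<epsilon>(1) CB by (simp_all add: r_def field_simps)
      let ?\<N> = "insert (smooth_forms M p)
        ((\<lambda>((c, K), bs). ?N \<alpha> c K bs r) ` (\<K> \<times> (basis_lists p :: (real ^ 'n) list set)))"
      have "openin ?X (\<Inter>?\<N>)"
        using \<K>(1) finite_basis_lists op[OF \<alpha>(1) _ _ r(1)] op_all by (intro openin_Inter) auto
      moreover have "\<alpha> \<in> \<Inter>?\<N>"
        using \<alpha>(1) r(1) by (auto simp: local_rep_def)
      moreover have "\<Inter>?\<N> \<subseteq> {\<alpha> \<in> topspace ?X. T \<alpha> \<in> W}"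
      proof
        fix \<beta> assume \<beta>: "\<beta> \<in> \<Inter>?\<N>"
        then have \<beta>s: "\<beta> \<in> smooth_forms M p" by simp
        have d: "\<beta> - \<alpha> \<in> smooth_forms M p"
          using subspace_smooth_forms \<beta>s \<alpha>(1) by (rule forms.subspace_diff)
        have "\<bar>T (\<beta> - \<alpha>)\<bar> \<le> C * r * B"
        proof (rule T_bound[OF d r(1)], unfold coeffs_bounded_def, intro allI impI, elim conjE)
          fix c K y bs assume "(c, K) \<in> \<K>" "y \<in> K" "bs \<in> (basis_lists p :: (real ^ 'n) list set)"
          then show "\<bar>local_rep M c (\<beta> - \<alpha>) bs y\<bar> \<le> r" using \<beta> by force
        qed
        moreover have "T \<beta> = T (\<beta> - \<alpha>) + T \<alpha>" using add[OF d \<alpha>(1)] by simp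
        ultimately have "T \<beta> \<in> ball (T \<alpha>) \<epsilon>" using r(2) by (simp add: dist_real_def)
        then show "\<beta> \<in> {\<alpha> \<in> topspace ?X. T \<alpha> \<in> W}" using \<epsilon>(2) \<beta>s by (auto simp: top)
      qed
      ultimately show "\<exists>N. openin ?X N \<and> \<alpha> \<in> N \<and> N \<subseteq> {\<alpha> \<in> topspace ?X. T \<alpha> \<in> W}" by blast
    qed
  qed simp
qed

end


section \<open>Positive forms\<close>

locale compact_calibrated_manifold =
  fixes M :: "('a, 'n::finite) riem_space" and p :: nat and \<phi> :: "('a, 'n) form"
  assumes calibrated: "calibrated_manifold M p \<phi>"
    and compact: "compact_space (underlying M)"

sublocale compact_calibrated_manifold \<subseteq> riemannian_manifold
  using calibrated by unfold_locales (simp add: calibrated_manifold_def)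

context compact_calibrated_manifold
begin

lemma phi_smooth: "\<phi> \<in> smooth_forms M p"
  using calibrated by (simp add: calibrated_manifold_def)

lemma unit_simple_eq: "unit_simple M p x = wedge M x ` unit_frames p x"
  by (auto simp: unit_simple_def unit_frames_def)

lemma wedge_frame:
  "\<beta> \<in> smooth_forms M p \<Longrightarrow> x \<in> points M \<Longrightarrow> vs \<in> unit_frames p x \<Longrightarrow> wedge M x vs (\<beta> x) = \<beta> x vs"
  using form_alt_space[of \<beta> p x] by (simp add: wedge_def unit_frames_def)

lemma comass_le_one_iff:
  "\<beta> \<in> smooth_forms M p \<Longrightarrow>
   comass_le_one M p \<beta> \<longleftrightarrow> (\<forall>x\<in>points M. \<forall>vs\<in>unit_frames p x. \<beta> x vs \<le> 1)"
  by (simp add: comass_le_one_def unit_simple_eq wedge_frame)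

lemma positive_form_iff:
  "positive_form M p \<phi> \<beta> \<longleftrightarrow> \<beta> \<in> smooth_forms M p \<and>
     (\<forall>x\<in>points M. \<forall>vs\<in>unit_frames p x. \<phi> x vs = 1 \<longrightarrow> \<beta> x vs \<ge> 0)"
proof -
  have "(\<forall>(x, \<xi>)\<in>phi_planes M p \<phi>. \<xi> (\<beta> x) \<ge> 0) \<longleftrightarrow>
      (\<forall>x\<in>points M. \<forall>vs\<in>unit_frames p x. wedge M x vs (\<phi> x) = 1 \<longrightarrow> wedge M x vs (\<beta> x) \<ge> 0)"
    unfolding phi_planes_def unit_simple_eq by blast
  then show ?thesis by (simp add: positive_form_def wedge_frame phi_smooth cong: conj_cong)
qed

lemma positive_add:
  "positive_form M p \<phi> \<alpha> \<Longrightarrow> positive_form M p \<phi> \<beta> \<Longrightarrow> positive_form M p \<phi> (\<alpha> + \<beta>)"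
  by (simp add: positive_form_iff form_add)

lemma positive_scale:
  "positive_form M p \<phi> \<beta> \<Longrightarrow> r \<ge> 0 \<Longrightarrow> positive_form M p \<phi> (form_scale r \<beta>)"
  by (simp add: positive_form_iff form_scale) (simp add: form_scale_def)

lemma ext_d_zero: "ext_d M 0 = 0"
  using ext_d_scale[OF form_zero, of 0] by (simp add: form_scale_def zero_fun_def)

lemma form_diff: "\<alpha> \<in> smooth_forms M k \<Longrightarrow> \<beta> \<in> smooth_forms M k \<Longrightarrow> \<alpha> - \<beta> \<in> smooth_forms M k"
  using forms.subspace_diff[OF subspace_smooth_forms] .

lemma form_uminus: "\<alpha> \<in> smooth_forms M k \<Longrightarrow> - \<alpha> \<in> smooth_forms M k"
  using forms.subspace_neg[OF subspace_smooth_forms] .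

text \<open>On a \<open>\<phi>\<close>-plane the form \<open>\<phi>\<close> has the value \<open>1\<close>, so that a multiple of \<open>\<phi>\<close> dominates every form of
  bounded comass there: \<open>\<phi>\<close> is an order unit for the cone of positive forms.\<close>
lemma phi_dominates:
  assumes "\<beta> \<in> smooth_forms M p" "comass_bounded p \<beta> s"
  shows "positive_form M p \<phi> (form_scale s \<phi> - \<beta>)" "positive_form M p \<phi> (form_scale s \<phi> + \<beta>)"
proof -
  have "- s \<le> \<beta> x vs \<and> \<beta> x vs \<le> s" if "x \<in> points M" "vs \<in> unit_frames p x" for x vs
    using assms(2) that abs_le_iff[of "\<beta> x vs" s] unfolding comass_bounded_def by force
  moreover have "form_scale s \<phi> x vs = s * \<phi> x vs" for x vs by (simp add: form_scale_def)
  ultimately show "positive_form M p \<phi> (form_scale s \<phi> - \<beta>)"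
    "positive_form M p \<phi> (form_scale s \<phi> + \<beta>)"
    using assms(1) phi_smooth
    by (simp_all add: positive_form_iff form_diff form_add form_scale) (smt (verit))
qed

lemma phi_minus_comass_one:
  assumes "\<psi> \<in> smooth_forms M p" "comass_le_one M p \<psi>"
  shows "positive_form M p \<phi> (\<phi> - \<psi>)"
  using assms phi_smooth by (auto simp: positive_form_iff comass_le_one_iff form_diff)

end

section \<open>Filling by a positive current\<close>

locale calibrated_current = compact_calibrated_manifold M p \<phi>
  for M :: "('a, 'n::finite) riem_space" and p :: nat and \<phi> :: "('a, 'n) form" +
  fixes S :: "('a, 'n) form \<Rightarrow> real" and l :: real
  assumes p: "p \<ge> 1" and S: "S \<in> currents M (p - 1)" and l: "l > 0"
    and S_bound: "\<And>\<alpha>. \<alpha> \<in> smooth_forms M (p - 1) \<Longrightarrow> positive_form M p \<phi> (ext_d M \<alpha> + \<phi>) \<Longrightarrow> S \<alpha> \<ge> - l"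
begin

text \<open>Upper bounds for the value at \<open>\<beta>\<close> of any current \<open>T\<close> as desired: if \<open>T\<close> is positive with
  \<open>\<partial>T = S\<close> and \<open>T \<phi> \<le> l\<close>, then \<open>T \<beta> \<le> T (d\<alpha> + s \<phi>) \<le> S \<alpha> + l s\<close> whenever \<open>d\<alpha> + s \<phi> - \<beta>\<close> is
  positive. The infimum of these bounds is the sublinear functional to be dominated.\<close>
definition costs :: "('a, 'n) form \<Rightarrow> real set" where
  "costs \<beta> = {S \<alpha> + l * s | \<alpha> s. \<alpha> \<in> smooth_forms M (p - 1) \<and> s \<ge> 0 \<and>
     positive_form M p \<phi> (ext_d M \<alpha> + form_scale s \<phi> - \<beta>)}"

lemma S_add:
  "\<alpha> \<in> smooth_forms M (p - 1) \<Longrightarrow> \<beta> \<in> smooth_forms M (p - 1) \<Longrightarrow> S (\<alpha> + \<beta>) = S \<alpha> + S \<beta>"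
  using S by (simp add: currents_def)

lemma S_scale: "\<alpha> \<in> smooth_forms M (p - 1) \<Longrightarrow> S (form_scale r \<alpha>) = r * S \<alpha>"
  using S by (simp add: currents_def)

lemma S_zero: "S 0 = 0"
  using S_scale[OF form_zero, of 0] by (simp add: form_scale_def zero_fun_def)

lemma ext_d_smooth_p: "\<alpha> \<in> smooth_forms M (p - 1) \<Longrightarrow> ext_d M \<alpha> \<in> smooth_forms M p"
  using ext_d_smooth[of \<alpha> "p - 1"] p by simp

lemma costsI:
  "\<alpha> \<in> smooth_forms M (p - 1) \<Longrightarrow> s \<ge> 0 \<Longrightarrow> positive_form M p \<phi> (ext_d M \<alpha> + form_scale s \<phi> - \<beta>) \<Longrightarrow>
   S \<alpha> + l * s \<in> costs \<beta>"
  by (auto simp: costs_def)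

lemma costs_nonempty: "\<beta> \<in> smooth_forms M p \<Longrightarrow> costs \<beta> \<noteq> {}"
proof -
  assume \<beta>: "\<beta> \<in> smooth_forms M p"
  obtain s where s: "s > 0" "comass_bounded p \<beta> s"
    using smooth_form_comass_bounded[OF compact \<beta>] by blast
  then have "S 0 + l * s \<in> costs \<beta>"
    using phi_dominates[OF \<beta>] by (intro costsI form_zero) (simp_all add: ext_d_zero)
  then show ?thesis by blast
qed

text \<open>The hypothesis on \<open>S\<close>, rescaled.\<close>
lemma S_lower_bound:
  assumes \<alpha>: "\<alpha> \<in> smooth_forms M (p - 1)" and "t > 0"
    and pos: "positive_form M p \<phi> (ext_d M \<alpha> + form_scale t \<phi>)"
  shows "S \<alpha> \<ge> - (l * t)"
proof -
  have "form_scale (1 / t) (ext_d M \<alpha> + form_scale t \<phi>) = ext_d M (form_scale (1 / t) \<alpha>) + \<phi>"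
    using \<open>t > 0\<close> by (simp add: ext_d_scale[OF \<alpha>]) (simp add: form_scale_def fun_eq_iff field_simps)
  then have "positive_form M p \<phi> (ext_d M (form_scale (1 / t) \<alpha>) + \<phi>)"
    using positive_scale[OF pos, of "1 / t"] \<open>t > 0\<close> by simp
  then have "S (form_scale (1 / t) \<alpha>) \<ge> - l" by (intro S_bound form_scale \<alpha>)
  then show ?thesis using \<open>t > 0\<close> by (simp add: S_scale[OF \<alpha>] field_simps)
qed

text \<open>If \<open>d\<alpha> + s \<phi> - \<beta>\<close> is positive, adding the positive form \<open>t \<phi> + \<beta>\<close> removes \<open>\<beta>\<close> and leads back to
  the hypothesis on \<open>S\<close>.\<close>
lemma costs_bdd_below: "\<beta> \<in> smooth_forms M p \<Longrightarrow> bdd_below (costs \<beta>)"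
proof -
  assume \<beta>: "\<beta> \<in> smooth_forms M p"
  obtain t where t: "t > 0" "comass_bounded p \<beta> t"
    using smooth_form_comass_bounded[OF compact \<beta>] by blast
  have "- (l * t) \<le> S \<alpha> + l * s"
    if "\<alpha> \<in> smooth_forms M (p - 1)" "s \<ge> 0"
      "positive_form M p \<phi> (ext_d M \<alpha> + form_scale s \<phi> - \<beta>)" for \<alpha> s
  proof -
    have "(ext_d M \<alpha> + form_scale s \<phi> - \<beta>) + (form_scale t \<phi> + \<beta>) = ext_d M \<alpha> + form_scale (s + t) \<phi>"
      by (simp add: forms.scale_left_distrib)
    then have "positive_form M p \<phi> (ext_d M \<alpha> + form_scale (s + t) \<phi>)"
      using positive_add[OF that(3) phi_dominates(2)[OF \<beta> t(2)]] by simp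
    then have "S \<alpha> \<ge> - (l * (s + t))" using that t(1) by (intro S_lower_bound) auto
    then show ?thesis by (simp add: distrib_left)
  qed
  then show ?thesis by (intro bdd_belowI[of _ "- (l * t)"]) (auto simp: costs_def)
qed

lemma costs_sublinear: "sublinear_on (smooth_forms M p) form_scale (\<lambda>\<beta>. Inf (costs \<beta>))"
  unfolding sublinear_on_def
proof (intro conjI ballI allI impI)
  fix \<beta> \<gamma> assume \<beta>: "\<beta> \<in> smooth_forms M p" and \<gamma>: "\<gamma> \<in> smooth_forms M p"
  have sum_le: "Inf (costs (\<beta> + \<gamma>)) \<le> a + b" if ab: "a \<in> costs \<beta>" "b \<in> costs \<gamma>" for a b
  proof -
    obtain \<alpha> s where 1: "a = S \<alpha> + l * s" "\<alpha> \<in> smooth_forms M (p - 1)" "s \<ge> 0"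
      "positive_form M p \<phi> (ext_d M \<alpha> + form_scale s \<phi> - \<beta>)" using ab(1) unfolding costs_def by blast
    obtain \<alpha>' t where 2: "b = S \<alpha>' + l * t" "\<alpha>' \<in> smooth_forms M (p - 1)" "t \<ge> 0"
      "positive_form M p \<phi> (ext_d M \<alpha>' + form_scale t \<phi> - \<gamma>)" using ab(2) unfolding costs_def by blast
    have eq: "(ext_d M \<alpha> + form_scale s \<phi> - \<beta>) + (ext_d M \<alpha>' + form_scale t \<phi> - \<gamma>) =
        ext_d M (\<alpha> + \<alpha>') + form_scale (s + t) \<phi> - (\<beta> + \<gamma>)"
      by (simp add: forms.scale_left_distrib ext_d_add[OF 1(2) 2(2)])
    have "positive_form M p \<phi> (ext_d M (\<alpha> + \<alpha>') + form_scale (s + t) \<phi> - (\<beta> + \<gamma>))"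
      using positive_add[OF 1(4) 2(4)] by (simp only: eq)
    then have "S (\<alpha> + \<alpha>') + l * (s + t) \<in> costs (\<beta> + \<gamma>)"
      using 1 2 by (intro costsI form_add) auto
    moreover have "S (\<alpha> + \<alpha>') + l * (s + t) = a + b"
      by (simp add: S_add[OF 1(2) 2(2)] 1(1) 2(1) distrib_left)
    ultimately show ?thesis using costs_bdd_below[OF form_add[OF \<beta> \<gamma>]] by (simp add: cInf_lower)
  qed
  have "Inf (costs (\<beta> + \<gamma>)) - a \<le> b" if "a \<in> costs \<beta>" "b \<in> costs \<gamma>" for a b
    using sum_le[OF that] by linarith
  then have diff_le: "Inf (costs (\<beta> + \<gamma>)) - a \<le> Inf (costs \<gamma>)" if "a \<in> costs \<beta>" for a
    using that by (intro cInf_greatest costs_nonempty \<gamma>)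
  have "Inf (costs (\<beta> + \<gamma>)) - Inf (costs \<gamma>) \<le> a" if "a \<in> costs \<beta>" for a
    using diff_le[OF that] by linarith
  then have "Inf (costs (\<beta> + \<gamma>)) - Inf (costs \<gamma>) \<le> Inf (costs \<beta>)"
    by (intro cInf_greatest costs_nonempty \<beta>)
  then show "Inf (costs (\<beta> + \<gamma>)) \<le> Inf (costs \<beta>) + Inf (costs \<gamma>)" by simp
next
  fix \<beta> and r :: real assume \<beta>: "\<beta> \<in> smooth_forms M p" and r: "r > 0"
  have "Inf (costs (form_scale r \<beta>)) / r \<le> a" if a: "a \<in> costs \<beta>" for a
  proof -
    obtain \<alpha> s where 1: "a = S \<alpha> + l * s" "\<alpha> \<in> smooth_forms M (p - 1)" "s \<ge> 0"
      "positive_form M p \<phi> (ext_d M \<alpha> + form_scale s \<phi> - \<beta>)" using a unfolding costs_def by blast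
    have eq: "form_scale r (ext_d M \<alpha> + form_scale s \<phi> - \<beta>) =
        ext_d M (form_scale r \<alpha>) + form_scale (r * s) \<phi> - form_scale r \<beta>"
      by (simp add: forms.scale_right_distrib forms.scale_right_diff_distrib ext_d_scale[OF 1(2)])
    have "positive_form M p \<phi> (ext_d M (form_scale r \<alpha>) + form_scale (r * s) \<phi> - form_scale r \<beta>)"
      using positive_scale[OF 1(4), of r] r by (simp only: eq)
    then have "S (form_scale r \<alpha>) + l * (r * s) \<in> costs (form_scale r \<beta>)"
      using 1 r by (intro costsI form_scale) auto
    then have "Inf (costs (form_scale r \<beta>)) \<le> S (form_scale r \<alpha>) + l * (r * s)"
      using costs_bdd_below[OF form_scale[OF \<beta>]] by (rule cInf_lower)
    also have "\<dots> = r * a" by (simp add: S_scale[OF 1(2)] 1(1) algebra_simps)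
    finally show ?thesis using r by (simp add: field_simps)
  qed
  then have "Inf (costs (form_scale r \<beta>)) / r \<le> Inf (costs \<beta>)"
    by (intro cInf_greatest costs_nonempty \<beta>)
  then show "Inf (costs (form_scale r \<beta>)) \<le> r * Inf (costs \<beta>)" using r by (simp add: field_simps)
qed

text \<open>A linear functional below the infimum of the costs has all the required properties. Special
  choices of \<open>(\<alpha>, s)\<close> show them: \<open>(0, 0)\<close> gives positivity, \<open>(0, 1)\<close> the bound at \<open>\<phi>\<close>, and
  \<open>(\<plusminus>\<alpha>, 0)\<close> the boundary. Positivity then yields the mass bound and continuity, because \<open>\<phi> - \<psi>\<close> is
  positive for each \<open>\<psi>\<close> of comass at most one.\<close>
lemma positive_filling_exists:
  obtains T where "T \<in> currents M p" "positive_current M p \<phi> T" "S = boundary M (p - 1) T"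
    "mass M p T \<le> ereal l"
proof -
  interpret real_subspace "form_scale :: real \<Rightarrow> ('a, 'n) form \<Rightarrow> ('a, 'n) form" "smooth_forms M p"
    by unfold_locales (rule subspace_smooth_forms)
  obtain f where add: "\<And>\<beta> \<gamma>. \<beta> \<in> smooth_forms M p \<Longrightarrow> \<gamma> \<in> smooth_forms M p \<Longrightarrow> f (\<beta> + \<gamma>) = f \<beta> + f \<gamma>"
    and scale: "\<And>r \<beta>. \<beta> \<in> smooth_forms M p \<Longrightarrow> f (form_scale r \<beta>) = r * f \<beta>"
    and le: "\<And>\<beta>. \<beta> \<in> smooth_forms M p \<Longrightarrow> f \<beta> \<le> Inf (costs \<beta>)"
    by (rule hahn_banach[OF costs_sublinear]) (rule that; assumption)
  have neg: "f (- \<beta>) = - f \<beta>" if "\<beta> \<in> smooth_forms M p" for \<beta>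
    using scale[OF that, of "- 1"] by simp
  have upper: "f \<beta> \<le> S \<alpha> + l * s" if "\<beta> \<in> smooth_forms M p" "\<alpha> \<in> smooth_forms M (p - 1)" "s \<ge> 0"
      "positive_form M p \<phi> (ext_d M \<alpha> + form_scale s \<phi> - \<beta>)" for \<beta> \<alpha> s
    using le[OF that(1)] cInf_lower[OF costsI[OF that(2-4)] costs_bdd_below[OF that(1)]] by simp
  have zero_pos: "positive_form M p \<phi> 0" by (simp add: positive_form_iff form_zero)
  have pos: "f \<beta> \<ge> 0" if "positive_form M p \<phi> \<beta>" for \<beta>
  proof -
    have \<beta>: "\<beta> \<in> smooth_forms M p" using that by (simp add: positive_form_def)
    have "f (- \<beta>) \<le> S 0 + l * 0"
      using that by (intro upper form_uminus \<beta> form_zero) (simp_all add: ext_d_zero)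
    then show ?thesis by (simp add: neg[OF \<beta>] S_zero)
  qed
  have f_phi: "f \<phi> \<le> l"
    using upper[OF phi_smooth form_zero, of 1] zero_pos by (simp add: S_zero ext_d_zero)
  have f_d: "f (ext_d M \<alpha>) = S \<alpha>" if \<alpha>: "\<alpha> \<in> smooth_forms M (p - 1)" for \<alpha>
  proof -
    have "f (ext_d M \<alpha>) \<le> S \<alpha>" if "\<alpha> \<in> smooth_forms M (p - 1)" for \<alpha>
      using upper[OF ext_d_smooth_p[OF that] that, of 0] zero_pos by simp
    from this[OF \<alpha>] this[OF form_scale[OF \<alpha>, of "- 1"]] show ?thesis
      by (simp only: ext_d_scale[OF \<alpha>] S_scale[OF \<alpha>] scale[OF ext_d_smooth_p[OF \<alpha>]])
  qed
  have f_bound: "\<bar>f \<beta>\<bar> \<le> l" if \<beta>: "\<beta> \<in> smooth_forms M p" and "comass_bounded p \<beta> 1" for \<beta>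
  proof -
    have "f (\<phi> + \<beta>) \<ge> 0" "f (\<phi> + - \<beta>) \<ge> 0"
      using phi_dominates[OF that] by (intro pos; simp)+
    then show ?thesis
      using f_phi by (simp add: add phi_smooth \<beta> neg form_uminus[OF \<beta>] del: add_uminus_conv_diff)
  qed
  let ?T = "restrict f (smooth_forms M p)"
  show thesis
  proof (rule that[of ?T])
    have "continuous_map (form_topology M p) euclideanreal ?T"
      using f_bound l
      by (intro bounded_functional_continuous[where B = l] compact)
          (auto simp: add scale form_add form_scale)
    then show "?T \<in> currents M p"
      by (simp add: currents_def add scale form_add form_scale)
    show "positive_current M p \<phi> ?T"
      using pos by (simp add: positive_current_def positive_form_def)
    show "S = boundary M (p - 1) ?T"
    proof
      fix \<alpha>
      show "S \<alpha> = boundary M (p - 1) ?T \<alpha>"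
      proof (cases "\<alpha> \<in> smooth_forms M (p - 1)")
        case True
        then show ?thesis by (simp add: boundary_def f_d ext_d_smooth_p)
      next
        case False
        then show ?thesis using S by (simp add: boundary_def currents_def extensional_def)
      qed
    qed
    show "mass M p ?T \<le> ereal l"
      unfolding mass_def
    proof (rule SUP_least)
      fix \<psi> assume "\<psi> \<in> {\<psi> \<in> smooth_forms M p. comass_le_one M p \<psi>}"
      then have \<psi>: "\<psi> \<in> smooth_forms M p" "comass_le_one M p \<psi>" by auto
      have "f (\<phi> + - \<psi>) \<ge> 0" using phi_minus_comass_one[OF \<psi>] by (intro pos) simp
      then have "f \<psi> \<le> l"
        using f_phi by (simp add: add phi_smooth neg \<psi> form_uminus del: add_uminus_conv_diff)
      then show "ereal (?T \<psi>) \<le> ereal l" using \<psi> by simp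
    qed
  qed
qed

end

context compact_calibrated_manifold
begin

text \<open>The direct implication: \<open>S \<alpha> = T (d\<alpha> + \<phi>) - T \<phi> \<ge> - T \<phi> \<ge> - M(T)\<close>, as \<open>\<phi>\<close> has comass at most one.\<close>
lemma positive_filling_bound:
  assumes p: "p \<ge> 1" and T: "T \<in> currents M p" "positive_current M p \<phi> T" "mass M p T \<le> ereal l"
    and \<alpha>: "\<alpha> \<in> smooth_forms M (p - 1)" "positive_form M p \<phi> (ext_d M \<alpha> + \<phi>)"
  shows "boundary M (p - 1) T \<alpha> \<ge> - l"
proof -
  have d: "ext_d M \<alpha> \<in> smooth_forms M p" using ext_d_smooth[OF \<alpha>(1)] p by simp
  have "compactly_supported M (ext_d M \<alpha> + \<phi>)"
    using compact by (simp add: compactly_supported_def closedin_compact_space)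
  then have "0 \<le> T (ext_d M \<alpha> + \<phi>)" using T(2) \<alpha>(2) by (simp add: positive_current_def)
  also have "\<dots> = T (ext_d M \<alpha>) + T \<phi>" using T(1) d phi_smooth by (simp add: currents_def)
  finally have "T (ext_d M \<alpha>) \<ge> - T \<phi>" by simp
  moreover have "ereal (T \<phi>) \<le> mass M p T"
    unfolding mass_def using calibrated by (intro SUP_upper) (simp add: calibrated_manifold_def)
  then have "T \<phi> \<le> l" using T(3) by (metis ereal_less_eq(3) order_trans)
  ultimately show ?thesis using \<alpha>(1) by (simp add: boundary_def)
qed

end

theorem theorem4p3:
  fixes M :: "('a, 'n::finite) riem_space" and \<phi> :: "('a, 'n) form" and p :: nat
    and S :: "('a, 'n) form \<Rightarrow> real" and l :: real
  assumes "calibrated_manifold M p \<phi>" and "compact_space (underlying M)" and "p \<ge> 1"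
    and "S \<in> currents M (p - 1)" and "l > 0"
  shows "(\<exists>T \<in> currents M p. positive_current M p \<phi> T \<and> S = boundary M (p - 1) T \<and>
            mass M p T \<le> ereal l)
     \<longleftrightarrow> (\<forall>\<alpha> \<in> smooth_forms M (p - 1). positive_form M p \<phi> (ext_d M \<alpha> + \<phi>) \<longrightarrow> S \<alpha> \<ge> - l)"
    (is "?fills \<longleftrightarrow> ?bound")
proof -
  interpret compact_calibrated_manifold M p \<phi>
    using assms by unfold_locales
  show ?thesis
  proof
    assume ?fills
    then show ?bound using positive_filling_bound[OF assms(3)] by blast
  next
    assume ?bound
    then interpret calibrated_current M p \<phi> S l
      using assms by unfold_locales auto
    show ?fills using positive_filling_exists by blast
  qed
qed

end
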